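(* Let $M = M^0(S; F(I), G(\Lambda); P)$ be a Rees matrix semigroup with zero over a semigroupoid $S$. If $M$ is prefix-automatic then $S$ is prefix-automatic.
   Context: Semigroupoids. A (directed) graph $X$ has a set $X^0$ of vertices, a set $X^1$ of edges, and source and target maps $\alpha,\omega: X^1\to X^0$. A semigroupoid $S$ is a small graph (vertices are called objects, edges are called arrows) with a partial multiplication on arrows such that $ef$ is defined if and only if $\omega(e)=\alpha(f)$, in which case $\alpha(ef)=\alpha(e)$ and $\omega(ef)=\omega(f)$, and $e(fg)=(ef)g$ whenever $ef$ and $fg$ are defined. (Thus a semigroupoid is a small category without the requirement of identities.) We write $s\in S$ for $s\in S^1$. $S$ is isolation-free if every object is the source or target of some arrow. A semigroup is regarded as a semigroupoid with one object. Paths and regularity. For a graph $X$, $X^+$ is the free semigroupoid on $X$: its objects are $X^0$, its arrows are the non-empty paths $e_1\cdots e_n$ with $\omega(e_i)=\alpha(e_{i+1})$. All graphs over which regularity is considered are finite. A language $L\subseteq X^+$ is regular if it is regular in the usual sense as a set of words over the alphabet $X^1$ (equivalently, it is accepted by a finite automaton labelled by the graph $X$). Let $X^{\$}$ be $X$ with one extra loop $\$_s$ at each vertex $s$. For $(a,b)\in X^+\times X^+$, let $\delta_X(a,b)\in (X^{\$}\times X^{\$})^+$ be the path obtained by padding the shorter of $a,b$ on the right with copies of $\$_t$, where $t$ is the target of that shorter path, to the length of the longer one, and reading the two paths as a single path of pairs of edges. A relation $R\subseteq X^+\times X^+$ is synchronously regular if $\delta_X(R)$ is a regular language (over the edges of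 $X^{\$}\times X^{\$}$). Automaticity. A choice of representatives for a semigroupoid $S$ is a triple $(X,K,\rho)$ where $X$ is a graph with $X^0=S^0$, $\rho:X^+\to S$ is a surjective semigroupoid morphism that is the identity on objects, and $K\subseteq X^+$ satisfies $\rho(K)=S^1$. It is finitely generated if $X$ has finitely many edges. An automatic structure for $S$ is a finitely generated choice of representatives $(X,K,\rho)$ such that the relation $K_a=\{(u,v)\in K\times K : \omega(u)=\alpha(a),\ \rho(ua)=\rho(v)\}$ is synchronously regular for each edge $a\in X^1$, and the relation $K_a=\{(u,v)\in K\times K: \omega(u)=a,\ \rho(u)=\rho(v)\}$ is synchronously regular for each vertex $a\in X^0$ (regarded as an empty path). A prefix-automatic structure is an automatic structure $(X,K,\rho)$ such that moreover $K'_= = \{(u,v)\in K\times \mathrm{Pref}(K): \rho(u)=\rho(v)\}$ is synchronously regular, where $\mathrm{Pref}(K)$ is the set of non-empty prefixes of paths in $K$. $S$ is prefix-automatic if it admits a prefix-automatic structure. Rees matrix semigroups. Let $S$ be a non-empty isolation-free semigroupoid, $I,\Lambda$ index sets, $F:I\to\alpha(S^1)$ and $G:\Lambda\to\omega(S^1)$ surjective functions, $0$ a new symbol not in $S$, and $P$ a $\Lambda\times I$ matrix with entries in $S\cup\{0\}$ such that $\alpha(P_{\lambda i})=G(\lambda)$ and $\omega(P_{\lambda i})=F(i)$ whenever $P_{\lambda i}\neq 0$. The Rees matrix semigroup with zero $M^0(S;F(I),G(\Lambda);P)$ (the notation $F(I),G(\Lambda)$ is purely symbolic) has elements $\{0\}\cup\{(i,x,\lambda)\in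 I\times S\times\Lambda : F(i)=\alpha(x),\ \omega(x)=G(\lambda)\}$, with $(i,x,\lambda)(j,y,\mu)=(i,xP_{\lambda j}y,\mu)$ if $P_{\lambda j}\ne 0$ and $=0$ otherwise, and $0m=m0=0$ for all $m$. *)

theory Defs
  imports "Graph_Theory.Digraph" "Graph_Theory.Arc_Walk" "HOL-Library.Sublist"
begin

section \<open>Semigroupoids\<close>

record ('o, 's) semigroupoid = "('o, 's) pre_digraph" +
  mult :: "'s \<Rightarrow> 's \<Rightarrow> 's"

text \<open>
  Objects are the vertices, arrows the arcs; the maps written alpha and omega in the literature
  are \<open>tail\<close> and \<open>head\<close>. The product of \<open>e\<close> and \<open>f\<close> is only meaningful when
  \<open>head S e = tail S f\<close>; no use is made of \<open>mult S e f\<close> otherwise.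
\<close>

locale semigroupoid =
  fixes S :: "('o, 's) semigroupoid" (structure)
  assumes graph: "wf_digraph (pre_digraph.truncate S)"
    and mult_closed: "\<lbrakk>e \<in> arcs S; f \<in> arcs S; head S e = tail S f\<rbrakk> \<Longrightarrow> mult S e f \<in> arcs S"
    and tail_mult: "\<lbrakk>e \<in> arcs S; f \<in> arcs S; head S e = tail S f\<rbrakk> \<Longrightarrow> tail S (mult S e f) = tail S e"
    and head_mult: "\<lbrakk>e \<in> arcs S; f \<in> arcs S; head S e = tail S f\<rbrakk> \<Longrightarrow> head S (mult S e f) = head S f"
    and mult_assoc: "\<lbrakk>e \<in> arcs S; f \<in> arcs S; g \<in> arcs S; head S e = tail S f; head S f = tail S g\<rbrakk>
      \<Longrightarrow> mult S e (mult S f g) = mult S (mult S e f) g"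

definition isolation_free :: "('o, 's) semigroupoid \<Rightarrow> bool" where
  "isolation_free S \<longleftrightarrow> (\<forall>v\<in>verts S. \<exists>e\<in>arcs S. tail S e = v \<or> head S e = v)"

definition semigroupoid_hom ::
  "('o, 's) semigroupoid \<Rightarrow> ('p, 't) semigroupoid \<Rightarrow> ('o \<Rightarrow> 'p) \<Rightarrow> ('s \<Rightarrow> 't) \<Rightarrow> bool" where
  "semigroupoid_hom S T \<phi> \<psi> \<longleftrightarrow>
     (\<forall>v\<in>verts S. \<phi> v \<in> verts T) \<and>
     (\<forall>e\<in>arcs S. \<psi> e \<in> arcs T \<and> tail T (\<psi> e) = \<phi> (tail S e) \<and> head T (\<psi> e) = \<phi> (head S e)) \<and>
     (\<forall>e\<in>arcs S. \<forall>f\<in>arcs S. head S e = tail S f \<longrightarrow> \<psi> (mult S e f) = mult T (\<psi> e) (\<psi> f))"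

definition one_object :: "'s set \<Rightarrow> ('s \<Rightarrow> 's \<Rightarrow> 's) \<Rightarrow> (unit, 's) semigroupoid" where
  "one_object C m = \<lparr>verts = {()}, arcs = C, tail = (\<lambda>_. ()), head = (\<lambda>_. ()), mult = m\<rparr>"

text \<open>The free semigroupoid on a graph: its arrows are the non-empty paths.\<close>

definition free_semigroupoid :: "('v, 'e) pre_digraph \<Rightarrow> ('v, 'e list) semigroupoid" where
  "free_semigroupoid X =
     \<lparr>verts = verts X,
      arcs = {p. p \<noteq> [] \<and> (\<exists>u v. pre_digraph.awalk X u p v)},
      tail = (\<lambda>p. tail X (hd p)),
      head = (\<lambda>p. head X (last p)),
      mult = (@)\<rparr>"

lemma semigroupoid_free_semigroupoid:
  assumes "wf_digraph X"
  shows "semigroupoid (free_semigroupoid X)"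
proof -
  interpret wf_digraph X by fact
  have ends: "u = tail X (hd p) \<and> v = head X (last p)" if "awalk u p v" "p \<noteq> []" for u p v
  proof -
    have "cas u p v" using that by (simp add: awalk_def)
    with \<open>p \<noteq> []\<close> show ?thesis by (induction u p v rule: cas.induct) (auto split: if_splits)
  qed
  have append: "\<exists>u v. awalk u (p @ q) v"
    if "awalk u p v" "p \<noteq> []" "awalk u' q v'" "q \<noteq> []" "head X (last p) = tail X (hd q)" for u v u' v' p q
    using that ends by (metis awalk_appendI)
  have in_verts: "tail X (hd p) \<in> verts X" "head X (last p) \<in> verts X" if "awalk u p v" "p \<noteq> []" for u p v
    using that hd_in_set[of p] last_in_set[of p] by (auto simp: awalk_def subset_iff)
  show ?thesis
  proof (rule semigroupoid.intro)
    show "wf_digraph (pre_digraph.truncate (free_semigroupoid X))"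
      by unfold_locales (auto simp: free_semigroupoid_def pre_digraph.truncate_def in_verts)
  qed (auto simp: free_semigroupoid_def append)
qed


section \<open>Synchronously regular relations\<close>

text \<open>
  Acceptance by a complete deterministic finite automaton over the finite alphabet \<open>A\<close>. Taking
  the states to be natural numbers is no restriction, since there are only finitely many of them.
\<close>

definition regular_language :: "'x set \<Rightarrow> 'x list set \<Rightarrow> bool" where
  "regular_language A L \<longleftrightarrow> finite A \<and>
     (\<exists>(Q :: nat set) \<delta> q\<^sub>0 F.
        finite Q \<and> q\<^sub>0 \<in> Q \<and> F \<subseteq> Q \<and> (\<forall>q\<in>Q. \<forall>a\<in>A. \<delta> q a \<in> Q) \<and>
        L = {w \<in> lists A. foldl \<delta> q\<^sub>0 w \<in> F})"

text \<open>\<open>Pad s\<close> is the additional loop (written with a dollar sign) at the vertex \<open>s\<close>.\<close>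

datatype ('v, 'e) padded_edge = Edge 'e | Pad 'v

definition padded_graph :: "('v, 'e) pre_digraph \<Rightarrow> ('v, ('v, 'e) padded_edge) pre_digraph" where
  "padded_graph X =
     \<lparr>verts = verts X,
      arcs = Edge ` arcs X \<union> Pad ` verts X,
      tail = case_padded_edge (tail X) (\<lambda>s. s),
      head = case_padded_edge (head X) (\<lambda>s. s)\<rparr>"

definition product_graph ::
  "('v, 'e) pre_digraph \<Rightarrow> ('w, 'f) pre_digraph \<Rightarrow> ('v \<times> 'w, 'e \<times> 'f) pre_digraph" where
  "product_graph X Y =
     \<lparr>verts = verts X \<times> verts Y,
      arcs = arcs X \<times> arcs Y,
      tail = map_prod (tail X) (tail Y),
      head = map_prod (head X) (head Y)\<rparr>"

definition pad_path :: "('v, 'e) pre_digraph \<Rightarrow> nat \<Rightarrow> 'e list \<Rightarrow> ('v, 'e) padded_edge list" where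
  "pad_path X n p = map Edge p @ replicate (n - length p) (Pad (head X (last p)))"

definition padded_pair ::
  "('v, 'e) pre_digraph \<Rightarrow> 'e list \<times> 'e list \<Rightarrow> (('v, 'e) padded_edge \<times> ('v, 'e) padded_edge) list" where
  "padded_pair X = (\<lambda>(a, b).
     let n = max (length a) (length b) in zip (pad_path X n a) (pad_path X n b))"

definition synchronously_regular ::
  "('v, 'e) pre_digraph \<Rightarrow> ('e list \<times> 'e list) set \<Rightarrow> bool" where
  "synchronously_regular X R \<longleftrightarrow>
     R \<subseteq> arcs (free_semigroupoid X) \<times> arcs (free_semigroupoid X) \<and>
     regular_language (arcs (product_graph (padded_graph X) (padded_graph X))) (padded_pair X ` R)"


section \<open>Automatic and prefix-automatic structures\<close>

definition choice_of_representatives ::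
  "('o, 's) semigroupoid \<Rightarrow> ('o, 'e) pre_digraph \<Rightarrow> 'e list set \<Rightarrow> ('e list \<Rightarrow> 's) \<Rightarrow> bool" where
  "choice_of_representatives S X K \<rho> \<longleftrightarrow>
     wf_digraph X \<and> verts X = verts S \<and>
     semigroupoid_hom (free_semigroupoid X) S id \<rho> \<and>
     \<rho> ` arcs (free_semigroupoid X) = arcs S \<and>
     K \<subseteq> arcs (free_semigroupoid X) \<and> \<rho> ` K = arcs S"

definition edge_relation ::
  "('o, 'e) pre_digraph \<Rightarrow> 'e list set \<Rightarrow> ('e list \<Rightarrow> 's) \<Rightarrow> 'e \<Rightarrow> ('e list \<times> 'e list) set" where
  "edge_relation X K \<rho> a =
     {(u, v) \<in> K \<times> K. head (free_semigroupoid X) u = tail X a \<and> \<rho> (u @ [a]) = \<rho> v}"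

definition vertex_relation ::
  "('o, 'e) pre_digraph \<Rightarrow> 'e list set \<Rightarrow> ('e list \<Rightarrow> 's) \<Rightarrow> 'o \<Rightarrow> ('e list \<times> 'e list) set" where
  "vertex_relation X K \<rho> s =
     {(u, v) \<in> K \<times> K. head (free_semigroupoid X) u = s \<and> \<rho> u = \<rho> v}"

definition automatic_structure ::
  "('o, 's) semigroupoid \<Rightarrow> ('o, 'e) pre_digraph \<Rightarrow> 'e list set \<Rightarrow> ('e list \<Rightarrow> 's) \<Rightarrow> bool" where
  "automatic_structure S X K \<rho> \<longleftrightarrow>
     choice_of_representatives S X K \<rho> \<and> finite (arcs X) \<and>
     (\<forall>a\<in>arcs X. synchronously_regular X (edge_relation X K \<rho> a)) \<and>
     (\<forall>s\<in>verts X. synchronously_regular X (vertex_relation X K \<rho> s))"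

definition Pref :: "'e list set \<Rightarrow> 'e list set" where
  "Pref K = {u. u \<noteq> [] \<and> (\<exists>w\<in>K. prefix u w)}"

definition prefix_automatic_structure ::
  "('o, 's) semigroupoid \<Rightarrow> ('o, 'e) pre_digraph \<Rightarrow> 'e list set \<Rightarrow> ('e list \<Rightarrow> 's) \<Rightarrow> bool" where
  "prefix_automatic_structure S X K \<rho> \<longleftrightarrow>
     automatic_structure S X K \<rho> \<and>
     synchronously_regular X {(u, v) \<in> K \<times> Pref K. \<rho> u = \<rho> v}"

text \<open>
  The generating graph of an automatic structure has only finitely many edges, so its edges may be
  named by natural numbers without loss of generality.
\<close>

definition prefix_automatic :: "('o, 's) semigroupoid \<Rightarrow> bool" where
  "prefix_automatic S \<longleftrightarrow>
     (\<exists>(X :: ('o, nat) pre_digraph) K \<rho>. prefix_automatic_structure S X K \<rho>)"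


section \<open>Rees matrix semigroups with zero over a semigroupoid\<close>

text \<open>\<open>None\<close> is the new symbol 0, both as a matrix entry and as an element of the semigroup.\<close>

locale rees_matrix_data = semigroupoid S
  for S :: "('o, 's) semigroupoid" +
  fixes I :: "'i set" and \<Lambda> :: "'l set"
    and F :: "'i \<Rightarrow> 'o" and G :: "'l \<Rightarrow> 'o" and P :: "'l \<Rightarrow> 'i \<Rightarrow> 's option"
  assumes non_empty: "arcs S \<noteq> {}"
    and isolation_free: "isolation_free S"
    and F_surj: "F ` I = tail S ` arcs S"
    and G_surj: "G ` \<Lambda> = head S ` arcs S"
    and P_entries: "\<lbrakk>l \<in> \<Lambda>; i \<in> I; P l i = Some p\<rbrakk> \<Longrightarrow> p \<in> arcs S \<and> tail S p = G l \<and> head S p = F i"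

definition rees_carrier ::
  "('o, 's) semigroupoid \<Rightarrow> 'i set \<Rightarrow> 'l set \<Rightarrow> ('i \<Rightarrow> 'o) \<Rightarrow> ('l \<Rightarrow> 'o) \<Rightarrow> ('i \<times> 's \<times> 'l) option set" where
  "rees_carrier S I \<Lambda> F G =
     insert None (Some ` {(i, x, l). i \<in> I \<and> x \<in> arcs S \<and> l \<in> \<Lambda> \<and> F i = tail S x \<and> head S x = G l})"

fun rees_mult ::
  "('o, 's) semigroupoid \<Rightarrow> ('l \<Rightarrow> 'i \<Rightarrow> 's option) \<Rightarrow>
   ('i \<times> 's \<times> 'l) option \<Rightarrow> ('i \<times> 's \<times> 'l) option \<Rightarrow> ('i \<times> 's \<times> 'l) option" where
  "rees_mult S P (Some (i, x, l)) (Some (j, y, m)) =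
     (case P l j of None \<Rightarrow> None | Some p \<Rightarrow> Some (i, mult S (mult S x p) y, m))"
| "rees_mult S P None b = None"
| "rees_mult S P a None = None"

definition rees_matrix_semigroup ::
  "('o, 's) semigroupoid \<Rightarrow> 'i set \<Rightarrow> 'l set \<Rightarrow> ('i \<Rightarrow> 'o) \<Rightarrow> ('l \<Rightarrow> 'o) \<Rightarrow>
   ('l \<Rightarrow> 'i \<Rightarrow> 's option) \<Rightarrow> (unit, ('i \<times> 's \<times> 'l) option) semigroupoid" where
  "rees_matrix_semigroup S I \<Lambda> F G P = one_object (rees_carrier S I \<Lambda> F G) (rees_mult S P)"

lemma (in rees_matrix_data) semigroupoid_rees_matrix_semigroup:
  "semigroupoid (rees_matrix_semigroup S I \<Lambda> F G P)"
proof -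
  have P1: "p \<in> arcs S" and P2: "tail S p = G l" and P3: "head S p = F i"
    if "P l i = Some p" "l \<in> \<Lambda>" "i \<in> I" for l i p
    using P_entries that by blast+
  note simps = P1 P2 P3 mult_closed tail_mult head_mult mult_assoc
  show ?thesis
    unfolding rees_matrix_semigroup_def one_object_def
    by unfold_locales
      (auto simp: pre_digraph.truncate_def rees_carrier_def simps split: option.splits)
qed

end

theory Submission
  imports Defs "HOL-Library.Stream" "HOL-Library.Countable"
begin

text \<open>
  Let \<open>K\<close> be the language of a prefix-automatic structure of \<open>M\<close>. A word \<open>a\<^sub>1 \<dots> a\<^sub>n\<close> over the
  generators \<open>(i\<^sub>k, s\<^sub>k, l\<^sub>k)\<close> of \<open>M\<close> has the middle component
  \<open>s\<^sub>1 (P\<^bsub>l\<^sub>1 i\<^sub>2\<^esub> s\<^sub>2) \<dots> (P\<^bsub>l\<^sub>n\<^sub>-\<^sub>1 i\<^sub>n\<^esub> s\<^sub>n)\<close>, so the arrows \<open>s\<^sub>k\<close> and \<open>P\<^bsub>l\<^sub>k i\<^sub>m\<^esub> s\<^sub>m\<close> generate \<open>S\<close>, and words of \<open>M\<close>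
  translate to paths by a length-preserving map that remembers the previous letter. The new language
  is the translation of the nonzero words of \<open>K\<close> whose first row is the one chosen for its object.
  If \<open>u = u' a\<close> represents \<open>(i, x, l)\<close> and \<open>g\<close> is an arrow (or absent), then \<open>v\<close> represents
  \<open>(i, x g, m)\<close> iff \<open>\<rho> u' \<cdot> (i\<^sub>a, s\<^sub>a g, m) = \<rho> v\<close>; replacing the prefix \<open>u'\<close> by an element of \<open>K\<close> makes
  this a composition of synchronously regular relations. Only finitely many \<open>a\<close> and \<open>m\<close> occur.

  Regularity is handled by finiteness of the set of residuals: once words are padded to infinite
  streams, relational composition needs no treatment of end markers.
\<close>

section \<open>Relations with finitely many residuals\<close>

definition residual :: "('a stream \<times> 'b stream) set \<Rightarrow> 'a list \<Rightarrow> 'b list \<Rightarrow> ('a stream \<times> 'b stream) set" where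
  "residual R p q = {(s, t). (p @- s, q @- t) \<in> R}"

text \<open>Both tracks are read in lockstep, hence the equal lengths. The residuals are the states
  of the minimal deterministic automaton reading pairs of letters, so finiteness of this set stands
  for regularity.\<close>

definition residuals :: "('a stream \<times> 'b stream) set \<Rightarrow> ('a stream \<times> 'b stream) set set" where
  "residuals R = {residual R p q |p q. length p = length q}"

section \<open>Closure under Boolean operations, converse and composition\<close>

lemma finite_residuals_Int:
  assumes "finite (residuals R)" "finite (residuals R')"
  shows "finite (residuals (R \<inter> R'))"
proof -
  have "residuals (R \<inter> R') \<subseteq> (\<lambda>(A, B). A \<inter> B) ` (residuals R \<times> residuals R')"
  proof
    fix A assume "A \<in> residuals (R \<inter> R')"
    then obtain p q where l: "length p = length q" and A: "A = residual (R \<inter> R') p q"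
      by (auto simp: residuals_def)
    have "A = residual R p q \<inter> residual R' p q"
      unfolding A residual_def by auto
    then show "A \<in> (\<lambda>(A, B). A \<inter> B) ` (residuals R \<times> residuals R')"
      using l unfolding residuals_def by blast
  qed
  with assms show ?thesis by (meson finite_SigmaI finite_imageI finite_subset)
qed

lemma finite_residuals_Un:
  assumes "finite (residuals R)" "finite (residuals R')"
  shows "finite (residuals (R \<union> R'))"
proof -
  have "residuals (R \<union> R') \<subseteq> (\<lambda>(A, B). A \<union> B) ` (residuals R \<times> residuals R')"
  proof
    fix A assume "A \<in> residuals (R \<union> R')"
    then obtain p q where l: "length p = length q" and A: "A = residual (R \<union> R') p q"
      by (auto simp: residuals_def)
    have "A = residual R p q \<union> residual R' p q"
      unfolding A residual_def by auto
    then show "A \<in> (\<lambda>(A, B). A \<union> B) ` (residuals R \<times> residuals R')"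
      using l unfolding residuals_def by blast
  qed
  with assms show ?thesis by (meson finite_SigmaI finite_imageI finite_subset)
qed

lemma finite_residuals_Diff:
  assumes "finite (residuals R)" "finite (residuals R')"
  shows "finite (residuals (R - R'))"
proof -
  have "residuals (R - R') \<subseteq> (\<lambda>(A, B). A - B) ` (residuals R \<times> residuals R')"
  proof
    fix A assume "A \<in> residuals (R - R')"
    then obtain p q where l: "length p = length q" and A: "A = residual (R - R') p q"
      by (auto simp: residuals_def)
    have "A = residual R p q - residual R' p q"
      unfolding A residual_def by auto
    then show "A \<in> (\<lambda>(A, B). A - B) ` (residuals R \<times> residuals R')"
      using l unfolding residuals_def by blast
  qed
  with assms show ?thesis by (meson finite_SigmaI finite_imageI finite_subset)
qed

lemma finite_residuals_converse:
  assumes "finite (residuals R)"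
  shows "finite (residuals (R\<inverse>))"
proof -
  have "residuals (R\<inverse>) \<subseteq> converse ` residuals R"
  proof
    fix A assume "A \<in> residuals (R\<inverse>)"
    then obtain p q where l: "length p = length q" and A: "A = residual (R\<inverse>) p q"
      by (auto simp: residuals_def)
    have "A = (residual R q p)\<inverse>"
      unfolding A residual_def by auto
    then show "A \<in> converse ` residuals R"
      using l unfolding residuals_def by (metis (mono_tags, lifting) imageI mem_Collect_eq)
  qed
  with assms show ?thesis by (meson finite_imageI finite_subset)
qed

text \<open>The intermediate element is an infinite stream, so it always has a prefix as long as
  \<open>p\<close> and \<open>r\<close>; cutting it there splits the composition.\<close>

lemma residual_relcomp:
  assumes "length p = length r"
  shows "residual (R O R') p r =
    (\<Union>q\<in>{q. length q = length p}. residual R p q O residual R' q r)"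
proof (intro equalityI subsetI)
  fix x assume "x \<in> residual (R O R') p r"
  then obtain s t y where x: "x = (s, t)" and y: "(p @- s, y) \<in> R" "(y, r @- t) \<in> R'"
    by (auto simp: residual_def)
  have "stake (length p) y @- sdrop (length p) y = y" by (rule stake_sdrop)
  with y have "(s, sdrop (length p) y) \<in> residual R p (stake (length p) y)"
    "(sdrop (length p) y, t) \<in> residual R' (stake (length p) y) r"
    by (auto simp: residual_def)
  then show "x \<in> (\<Union>q\<in>{q. length q = length p}. residual R p q O residual R' q r)"
    unfolding x by (intro UN_I[of "stake (length p) y"]) (auto simp: relcomp_unfold)
qed (auto simp: residual_def)

text \<open>This is the subset construction: guessing the prefix \<open>q\<close> of the
  intermediate stream reaches a set of pairs of residuals, and there are only finitely many such
  sets.\<close>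

lemma finite_residuals_relcomp:
  assumes "finite (residuals R)" "finite (residuals R')"
  shows "finite (residuals (R O R'))"
proof -
  have "residuals (R O R') \<subseteq>
    (\<lambda>Z. \<Union>(A, B)\<in>Z. A O B) ` Pow (residuals R \<times> residuals R')"
  proof
    fix A assume "A \<in> residuals (R O R')"
    then obtain p r where l: "length p = length r" and A: "A = residual (R O R') p r"
      by (auto simp: residuals_def)
    define Z where "Z = (\<lambda>q. (residual R p q, residual R' q r)) ` {q. length q = length p}"
    have "Z \<subseteq> residuals R \<times> residuals R'"
      unfolding Z_def residuals_def using l by force
    moreover have "A = (\<Union>(A, B)\<in>Z. A O B)"
      unfolding A Z_def residual_relcomp[OF l] by simp
    ultimately show "A \<in> (\<lambda>Z. \<Union>(A, B)\<in>Z. A O B) ` Pow (residuals R \<times> residuals R')" by blast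
  qed
  with assms show ?thesis by (meson finite_Pow_iff finite_SigmaI finite_imageI finite_subset)
qed

lemma residual_Nil: "residual R [] [] = R"
  by (simp add: residual_def)

lemma residual_Cons: "residual R (x # p) (y # q) = residual (residual R [x] [y]) p q"
  by (simp add: residual_def)

text \<open>A residual by long prefixes is an iterated residual by single letters, so any family
  that is closed under one step contains every reachable state.\<close>

lemma residuals_subset_closed:
  assumes "R \<in> C" and "\<And>A x y. A \<in> C \<Longrightarrow> residual A [x] [y] \<in> C"
  shows "residuals R \<subseteq> C"
proof -
  have "residual A p q \<in> C" if "length p = length q" "A \<in> C" for A p q
    using that
  proof (induction p q arbitrary: A rule: list_induct2)
    case (Cons x p y q)
    then show ?case by (subst residual_Cons) (auto intro: assms(2))
  qed (simp add: residual_Nil)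
  with \<open>R \<in> C\<close> show ?thesis by (auto simp: residuals_def)
qed


section \<open>Regular relations between words\<close>

definition blank :: "'a option stream" where
  "blank = sconst None"

lemma blank_unfold: "blank = None ## blank"
  unfolding blank_def by (subst siterate.ctr) simp

lemma blank_eq_SCons [simp]:
  "blank = x ## s \<longleftrightarrow> x = None \<and> s = blank" "x ## s = blank \<longleftrightarrow> x = None \<and> s = blank"
proof -
  show "blank = x ## s \<longleftrightarrow> x = None \<and> s = blank"
    by (subst blank_unfold) auto
  then show "x ## s = blank \<longleftrightarrow> x = None \<and> s = blank"
    by (simp only: eq_commute[of "x ## s"])
qed

lemma sdrop_blank [simp]: "sdrop n blank = blank"
  by (induction n) (simp, subst blank_unfold, simp)

lemma replicate_shift_blank [simp]: "replicate n None @- blank = blank"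
  by (induction n) simp_all

text \<open>Padding forever makes the padded form of a word independent of its partner. For this
  reason padding commutes with composition of relations.\<close>

definition padded_stream :: "'a list \<Rightarrow> 'a option stream" where
  "padded_stream u = map Some u @- blank"

lemma padded_stream_Nil: "padded_stream [] = blank"
  by (simp add: padded_stream_def)

lemma padded_stream_Cons: "padded_stream (a # u) = Some a ## padded_stream u"
  by (simp add: padded_stream_def)

lemma padded_stream_eq_Some: "padded_stream u = Some a ## s \<longleftrightarrow> (\<exists>v. u = a # v \<and> s = padded_stream v)"
  by (cases u) (auto simp: padded_stream_Nil padded_stream_Cons)

lemma padded_stream_eq_None: "padded_stream u = None ## s \<longleftrightarrow> u = [] \<and> s = blank"
  by (cases u) (auto simp: padded_stream_Nil padded_stream_Cons)

lemma padded_stream_inject: "padded_stream u = padded_stream v \<longleftrightarrow> u = v"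
proof (induction u arbitrary: v)
  case Nil
  then show ?case
    by (cases v) (simp_all add: padded_stream_Nil padded_stream_Cons)
next
  case (Cons a u)
  then show ?case
    by (cases v) (simp_all add: padded_stream_Nil padded_stream_Cons)
qed

definition padded_rel :: "('a list \<times> 'b list) set \<Rightarrow> ('a option stream \<times> 'b option stream) set" where
  "padded_rel R = map_prod padded_stream padded_stream ` R"

lemma inj_padded: "inj (map_prod padded_stream padded_stream)"
  by (auto intro!: injI simp: padded_stream_inject)

definition regular_rel :: "('a list \<times> 'b list) set \<Rightarrow> bool" where
  "regular_rel R \<longleftrightarrow> finite (residuals (padded_rel R))"

lemma regular_rel_Int: "regular_rel R \<Longrightarrow> regular_rel R' \<Longrightarrow> regular_rel (R \<inter> R')"
  by (simp add: regular_rel_def padded_rel_def image_Int[OF inj_padded] finite_residuals_Int)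

lemma regular_rel_Diff: "regular_rel R \<Longrightarrow> regular_rel R' \<Longrightarrow> regular_rel (R - R')"
  by (simp add: regular_rel_def padded_rel_def image_set_diff[OF inj_padded] finite_residuals_Diff)

lemma regular_rel_Un: "regular_rel R \<Longrightarrow> regular_rel R' \<Longrightarrow> regular_rel (R \<union> R')"
  by (simp add: regular_rel_def padded_rel_def image_Un finite_residuals_Un)

lemma regular_rel_converse: "regular_rel R \<Longrightarrow> regular_rel (R\<inverse>)"
proof -
  have "padded_rel (R\<inverse>) = (padded_rel R)\<inverse>"
    by (force simp: padded_rel_def)
  then show "regular_rel R \<Longrightarrow> regular_rel (R\<inverse>)"
    by (simp add: regular_rel_def finite_residuals_converse)
qed

lemma regular_rel_relcomp:
  assumes "regular_rel R" "regular_rel R'"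
  shows "regular_rel (R O R')"
proof -
  have "padded_rel (R O R') = padded_rel R O padded_rel R'"
    by (force simp: padded_rel_def relcomp_unfold padded_stream_inject)
  with assms show ?thesis
    by (simp add: regular_rel_def finite_residuals_relcomp)
qed

text \<open>\<open>C\<close> is a set of candidate states, given as relations between words instead
  of streams. The four closure conditions treat the next symbol on each track being a letter or a
  blank; once a track shows a blank, the rest of its word must be empty.\<close>

lemma regular_relI:
  assumes "finite C" "R \<in> C"
    and edges: "\<And>A a b. A \<in> C \<Longrightarrow> {(u, v). (a # u, b # v) \<in> A} \<in> C"
    and left: "\<And>A a. A \<in> C \<Longrightarrow> {(u, v). v = [] \<and> (a # u, []) \<in> A} \<in> C"
    and right: "\<And>A b. A \<in> C \<Longrightarrow> {(u, v). u = [] \<and> ([], b # v) \<in> A} \<in> C"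
    and ended: "\<And>A. A \<in> C \<Longrightarrow> A \<inter> {([], [])} \<in> C"
  shows "regular_rel R"
proof -
  have "residual (padded_rel A) [x] [y] \<in> padded_rel ` C" if A: "A \<in> C" for A x y
  proof -
    have eq: "residual (padded_rel A) [x] [y] =
      {(s, t). \<exists>u v. (u, v) \<in> A \<and> padded_stream u = x ## s \<and> padded_stream v = y ## t}"
      by (force simp: residual_def padded_rel_def)
    show ?thesis
    proof (cases x; cases y)
      assume "x = None" "y = None"
      then have "residual (padded_rel A) [x] [y] = padded_rel (A \<inter> {([], [])})"
        unfolding eq by (auto simp: padded_rel_def padded_stream_eq_None padded_stream_Nil)
      with ended[OF A] show ?thesis by simp
    next
      fix b assume "x = None" "y = Some b"
      then have "residual (padded_rel A) [x] [y] = padded_rel {(u, v). u = [] \<and> ([], b # v) \<in> A}"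
        unfolding eq
        by (force simp: padded_rel_def padded_stream_eq_None padded_stream_Nil padded_stream_eq_Some)
      with right[OF A] show ?thesis by simp
    next
      fix a assume "x = Some a" "y = None"
      then have "residual (padded_rel A) [x] [y] = padded_rel {(u, v). v = [] \<and> (a # u, []) \<in> A}"
        unfolding eq
        by (force simp: padded_rel_def padded_stream_eq_None padded_stream_Nil padded_stream_eq_Some)
      with left[OF A] show ?thesis by simp
    next
      fix a b assume "x = Some a" "y = Some b"
      then have "residual (padded_rel A) [x] [y] = padded_rel {(u, v). (a # u, b # v) \<in> A}"
        unfolding eq
        by (force simp: padded_rel_def padded_stream_eq_Some)
      with edges[OF A] show ?thesis by simp
    qed
  qed
  then have "residuals (padded_rel R) \<subseteq> padded_rel ` C"
    by (intro residuals_subset_closed) (use \<open>R \<in> C\<close> in auto)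
  with \<open>finite C\<close> show ?thesis
    by (auto simp: regular_rel_def intro: finite_subset)
qed

section \<open>Elementary regular relations and languages, a language \<open>L\<close> being treated
  as \<open>Id_on L\<close>\<close>

lemma regular_rel_empty: "regular_rel {}"
  by (rule regular_relI[where C="{{}}"]) auto

lemma regular_rel_UN: "finite H \<Longrightarrow> (\<And>h. h \<in> H \<Longrightarrow> regular_rel (R h)) \<Longrightarrow> regular_rel (\<Union>h\<in>H. R h)"
  by (induction H rule: finite_induct) (auto intro: regular_rel_empty regular_rel_Un)

lemma regular_rel_Id: "regular_rel Id"
  by (rule regular_relI[where C="{Id, {([], [])}, {}}"]) auto

text \<open>The three states are: still copying equal letters, finished after the final
  \<open>a\<close> has faced a blank, and failure.\<close>

lemma regular_rel_snoc: "regular_rel {(u @ [a], u) |u. True}" (is "regular_rel ?S")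
proof (rule regular_relI[where C="{?S, {([], [])}, {}}"])
  fix A b c
  have "{(u, v). (b # u, c # v) \<in> ?S} = (if b = c then ?S else {})"
    by (auto simp: Cons_eq_append_conv)
  moreover assume "A \<in> {?S, {([], [])}, {}}"
  ultimately show "{(u, v). (b # u, c # v) \<in> A} \<in> {?S, {([], [])}, {}}"
    by (elim insertE emptyE) simp_all
next
  fix A b
  assume "A \<in> {?S, {([], [])}, {}}"
  then show "{(u, v). v = [] \<and> (b # u, []) \<in> A} \<in> {?S, {([], [])}, {}}"
    by (cases "b = a"; elim insertE emptyE) auto
qed auto

lemma regular_rel_prefix: "regular_rel {(u, v). prefix u v}"
proof (rule regular_relI[where C="{{(u, v). prefix u v}, {(u, v). u = []}, {([], [])}, {}}"])
  fix A :: "('a list \<times> 'a list) set" and b c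
  assume "A \<in> {{(u, v). prefix u v}, {(u, v). u = []}, {([], [])}, {}}"
  then show "{(u, v). (b # u, c # v) \<in> A} \<in> {{(u, v). prefix u v}, {(u, v). u = []}, {([], [])}, {}}"
    by (cases "b = c"; elim insertE emptyE) simp_all
qed auto

lemma regular_rel_hd: "regular_rel (Id_on {u. u \<noteq> [] \<and> hd u \<in> A})" (is "regular_rel ?S")
proof (rule regular_relI[where C="{?S, Id, {([], [])}, {}}"])
  fix B b c
  have "{(u, v). (b # u, c # v) \<in> ?S} = (if b = c \<and> b \<in> A then Id else {})"
    "{(u, v). (b # u, c # v) \<in> Id} = (if b = c then Id else {})"
    by auto
  moreover assume "B \<in> {?S, Id, {([], [])}, {}}"
  ultimately show "{(u, v). (b # u, c # v) \<in> B} \<in> {?S, Id, {([], [])}, {}}"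
    by (elim insertE emptyE) simp_all
qed auto

text \<open>What remains to be read of a fixed pair is a pair of suffixes, and there are only
  finitely many of these.\<close>

lemma regular_rel_singleton: "regular_rel {(u, v)}"
proof (rule regular_relI[where C="Pow ({u'. suffix u' u} \<times> {v'. suffix v' v})"])
  have "{u'. suffix u' u} = set (suffixes u)" "{v'. suffix v' v} = set (suffixes v)"
    by auto
  then show "finite (Pow ({u'. suffix u' u} \<times> {v'. suffix v' v}))"
    by simp
qed (auto, (blast intro: suffix_ConsD)+)

text \<open>Projection reduces to composition: \<open>R O R\<inverse>\<close> relates words with a
  common image, and on the diagonal this says that some image exists.\<close>

lemma regular_rel_Domain: "regular_rel R \<Longrightarrow> regular_rel (Id_on (Domain R))"
proof -
  assume "regular_rel R"
  moreover have "Id_on (Domain R) = (R O R\<inverse>) \<inter> Id" by auto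
  ultimately show ?thesis
    by (simp add: regular_rel_Int regular_rel_relcomp regular_rel_converse regular_rel_Id)
qed

lemma regular_rel_Pref:
  assumes "regular_rel (Id_on L)"
  shows "regular_rel (Id_on (Pref L))"
proof -
  have "Id_on (Pref L) = Id_on (Domain ({(u, v). prefix u v} O Id_on L)) \<inter> Id_on {u. u \<noteq> [] \<and> hd u \<in> UNIV}"
    by (auto simp: Pref_def)
  with assms show ?thesis
    by (simp add: regular_rel_Int regular_rel_relcomp regular_rel_prefix regular_rel_Domain
        regular_rel_hd[of UNIV, simplified])
qed


section \<open>Synchronous regularity in terms of residuals\<close>

definition quotients :: "'x list set \<Rightarrow> 'x list set set" where
  "quotients L = range (\<lambda>w. {z. w @ z \<in> L})"

lemma finite_quotients_regular_language:
  assumes "regular_language A L"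
  shows "finite (quotients L)"
proof -
  from assms obtain Q :: "nat set" and \<delta> q\<^sub>0 F where Q: "finite Q" "q\<^sub>0 \<in> Q"
    "\<forall>q\<in>Q. \<forall>a\<in>A. \<delta> q a \<in> Q" and L: "L = {w \<in> lists A. foldl \<delta> q\<^sub>0 w \<in> F}"
    unfolding regular_language_def by blast
  have run: "foldl \<delta> q w \<in> Q" if "q \<in> Q" "w \<in> lists A" for q w
    using that(2,1) by (induction w arbitrary: q rule: lists.induct) (use Q(3) in auto)
  have "quotients L \<subseteq> insert {} ((\<lambda>q. {z \<in> lists A. foldl \<delta> q z \<in> F}) ` Q)"
  proof
    fix Z assume "Z \<in> quotients L"
    then obtain w where Z: "Z = {z. w @ z \<in> L}" by (auto simp: quotients_def)
    show "Z \<in> insert {} ((\<lambda>q. {z \<in> lists A. foldl \<delta> q z \<in> F}) ` Q)"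
    proof (cases "w \<in> lists A")
      case True
      then have "Z = {z \<in> lists A. foldl \<delta> (foldl \<delta> q\<^sub>0 w) z \<in> F}" by (auto simp: Z L)
      with run[OF Q(2) True] show ?thesis by blast
    qed (auto simp: Z L)
  qed
  with Q(1) show ?thesis by (meson finite.insertI finite_imageI finite_subset)
qed

text \<open>The quotients themselves are the states, and a quotient accepts if it contains the empty
  word. They are coded by an injection \<open>f\<close> because states have to be natural
  numbers.\<close>

lemma regular_languageI:
  assumes "finite A" "L \<subseteq> lists A" "finite (quotients L)"
  shows "regular_language A L"
proof -
  from assms(3) obtain f :: "'a list set \<Rightarrow> nat" where f: "inj_on f (quotients L)"
    using finite_imp_inj_to_nat_seg[OF assms(3)] by (elim exE conjE) (rule that)
  define g where "g = the_inv_into (quotients L) f"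
  have g: "g (f Z) = Z" if "Z \<in> quotients L" for Z
    using that f by (simp add: g_def the_inv_into_f_f)
  define \<delta> where "\<delta> = (\<lambda>q a. f {z. a # z \<in> g q})"
  have step: "{z. a # z \<in> Z} \<in> quotients L" if "Z \<in> quotients L" for Z a
  proof -
    from that obtain w where Z: "Z = {z. w @ z \<in> L}" by (auto simp: quotients_def)
    have "{z. a # z \<in> Z} = {z. (w @ [a]) @ z \<in> L}" by (simp add: Z)
    then show ?thesis unfolding quotients_def by blast
  qed
  have run: "foldl \<delta> (f Z) w = f {z. w @ z \<in> Z}" if "Z \<in> quotients L" for Z w
    using that
  proof (induction w arbitrary: Z)
    case (Cons a w)
    show ?case using Cons.IH[OF step[OF Cons.prems, of a]] by (simp add: \<delta>_def g[OF Cons.prems])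
  qed simp
  have init: "L \<in> quotients L" by (auto simp: quotients_def intro: range_eqI[of _ _ "[]"])
  have quot: "{z. w @ z \<in> L} \<in> quotients L" for w by (auto simp: quotients_def)
  have "L = {w \<in> lists A. foldl \<delta> (f L) w \<in> f ` {Z \<in> quotients L. [] \<in> Z}}"
  proof (intro equalityI subsetI)
    fix w assume "w \<in> L"
    then show "w \<in> {w \<in> lists A. foldl \<delta> (f L) w \<in> f ` {Z \<in> quotients L. [] \<in> Z}}"
      using assms(2) quot[of w] by (auto simp: run[OF init])
  next
    fix w assume "w \<in> {w \<in> lists A. foldl \<delta> (f L) w \<in> f ` {Z \<in> quotients L. [] \<in> Z}}"
    then obtain Z where "f {z. w @ z \<in> L} = f Z" "Z \<in> quotients L" "[] \<in> Z"
      by (auto simp: run[OF init])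
    with f quot[of w] have "{z. w @ z \<in> L} = Z" by (auto dest: inj_onD)
    with \<open>[] \<in> Z\<close> show "w \<in> L" by auto
  qed
  moreover have "\<forall>q\<in>f ` quotients L. \<forall>a\<in>A. \<delta> q a \<in> f ` quotients L"
    by (auto simp: \<delta>_def g step)
  ultimately show ?thesis
    unfolding regular_language_def using assms(1,3) init
    by (intro conjI exI[of _ "f ` quotients L"] exI[of _ \<delta>] exI[of _ "f L"]
        exI[of _ "f ` {Z \<in> quotients L. [] \<in> Z}"]) auto
qed

lemma finite_quotients_Int:
  assumes "finite (quotients L)" "finite (quotients L')"
  shows "finite (quotients (L \<inter> L'))"
proof -
  have "quotients (L \<inter> L') \<subseteq> (\<lambda>(A, B). A \<inter> B) ` (quotients L \<times> quotients L')"
  proof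
    fix Z assume "Z \<in> quotients (L \<inter> L')"
    then obtain w where "Z = {z. w @ z \<in> L} \<inter> {z. w @ z \<in> L'}"
      by (auto simp: quotients_def)
    then show "Z \<in> (\<lambda>(A, B). A \<inter> B) ` (quotients L \<times> quotients L')"
      unfolding quotients_def by blast
  qed
  with assms show ?thesis by (meson finite_SigmaI finite_imageI finite_subset)
qed

text \<open>Of a nonempty prefix satisfying the condition, only the last letter restricts the
  continuation.\<close>

lemma finite_quotients_successively:
  assumes "finite A"
  shows "finite (quotients {z \<in> lists A. successively Q z})" (is "finite (quotients ?L)")
proof -
  have "quotients ?L \<subseteq> insert {} (insert ?L ((\<lambda>a. {z \<in> lists A. successively Q (a # z)}) ` A))"
  proof
    fix Z assume "Z \<in> quotients ?L"
    then obtain w where Z: "Z = {z. w @ z \<in> ?L}" by (auto simp: quotients_def)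
    show "Z \<in> insert {} (insert ?L ((\<lambda>a. {z \<in> lists A. successively Q (a # z)}) ` A))"
    proof (cases w rule: rev_cases)
      case (snoc w' a)
      then show ?thesis
        by (cases "w \<in> ?L") (auto simp: Z successively_append_iff successively_Cons)
    qed (simp add: Z)
  qed
  with assms show ?thesis by (meson finite.insertI finite_imageI finite_subset)
qed

section \<open>From padded pairs over a one-vertex graph to pairs of streams\<close>

definition unpad :: "('v, 'e) padded_edge \<Rightarrow> 'e option" where
  "unpad = case_padded_edge Some (\<lambda>_. None)"

lemma unpad_simps [simp]: "unpad (Edge e) = Some e" "unpad (Pad v) = None"
  by (simp_all add: unpad_def)

lemma length_pad_path: "length u \<le> n \<Longrightarrow> length (pad_path X n u) = n"
  by (simp add: pad_path_def)

lemma unpad_pad_path: "map unpad (pad_path X n u) @- blank = padded_stream u"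
  by (simp add: pad_path_def padded_stream_def comp_def)

lemma padded_pair_components:
  "map fst (padded_pair X (u, v)) = pad_path X (max (length u) (length v)) u"
  "map snd (padded_pair X (u, v)) = pad_path X (max (length u) (length v)) v"
  by (simp_all add: padded_pair_def Let_def length_pad_path)

definition unpad_pair ::
  "(('v, 'e) padded_edge \<times> ('v, 'e) padded_edge) list \<Rightarrow> 'e option stream \<times> 'e option stream" where
  "unpad_pair z = (map unpad (map fst z) @- blank, map unpad (map snd z) @- blank)"

lemma unpad_pair_padded_pair: "unpad_pair (padded_pair X (u, v)) = (padded_stream u, padded_stream v)"
  unfolding unpad_pair_def padded_pair_components by (simp only: unpad_pad_path)

lemma padded_rel_eq_unpad_pair: "padded_rel R = unpad_pair ` padded_pair X ` R"
  by (force simp: padded_rel_def image_image unpad_pair_padded_pair split: prod.splits)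

text \<open>With only one vertex there is only one pad, so the padded edge can be recovered from its
  unpadded form.\<close>

definition repad :: "'e option \<Rightarrow> (unit, 'e) padded_edge" where
  "repad = case_option (Pad ()) Edge"

lemma repad_unpad [simp]: "repad (unpad x) = x"
  by (cases x) (auto simp: repad_def)

lemma unpad_repad [simp]: "unpad (repad x) = x"
  by (cases x) (auto simp: repad_def)

lemma shift_eq_shift:
  assumes "p @- s = p' @- s'" "length p \<le> length p'"
  shows "p = take (length p) p'" "s = drop (length p) p' @- s'"
proof -
  have "stake (length p) (p @- s) = stake (length p) (p' @- s')"
    and "sdrop (length p) (p @- s) = sdrop (length p) (p' @- s')"
    by (simp_all only: assms(1))
  with assms(2) show "p = take (length p) p'" "s = drop (length p) p' @- s'"
    by (simp_all add: stake_shift sdrop_shift)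
qed

text \<open>Over one vertex \<open>unpad\<close> loses nothing, so a residual corresponds to a
  quotient of the language of padded pairs, up to a possible extra pair of blank streams.\<close>

lemma regular_rel_if_synchronously_regular:
  fixes X :: "(unit, 'e) pre_digraph"
  assumes "synchronously_regular X R"
  shows "regular_rel R"
proof -
  define L where "L = padded_pair X ` R"
  have fin: "finite (quotients L)"
    using assms finite_quotients_regular_language unfolding synchronously_regular_def L_def by blast
  have R: "padded_rel R = unpad_pair ` L"
    unfolding L_def by (rule padded_rel_eq_unpad_pair)
  let ?D = "{{}, {(blank, blank)}} :: ('e option stream \<times> 'e option stream) set set"
  have "residuals (padded_rel R) \<subseteq> (\<lambda>(Z, D). unpad_pair ` Z \<union> D) ` (quotients L \<times> ?D)"
  proof
    fix B assume "B \<in> residuals (padded_rel R)"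
    then obtain p q where l: "length p = length q" and B: "B = residual (unpad_pair ` L) p q"
      by (auto simp: residuals_def R)
    define w where "w = zip (map repad p) (map repad q)"
    \<comment> \<open>The prefixes \<open>p\<close> and \<open>q\<close> may run past the end of a
      padded pair. No quotient of \<open>L\<close> by a word of their length sees such a pair, and
      all that it leaves behind is blank on both tracks.\<close>
    define D :: "('e option stream \<times> 'e option stream) set"
      where "D = {(blank, blank) |z. z \<in> L \<and> length z < length p \<and>
      unpad_pair z = (p @- blank, q @- blank)}"
    have w: "length w = length p" "map unpad (map fst w) = p" "map unpad (map snd w) = q"
      using l by (simp_all add: w_def comp_def)
    have "B = unpad_pair ` {z. w @ z \<in> L} \<union> D"
    proof (intro equalityI subsetI)
      fix x assume "x \<in> B"
      then obtain s t z where x: "x = (s, t)" and z: "z \<in> L" "unpad_pair z = (p @- s, q @- t)"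
        unfolding B residual_def by force
      from z(2) have eqs: "p @- s = map unpad (map fst z) @- blank"
        "q @- t = map unpad (map snd z) @- blank"
        by (simp_all add: unpad_pair_def)
      show "x \<in> unpad_pair ` {z. w @ z \<in> L} \<union> D"
      proof (cases "length p \<le> length z")
        case True
        from shift_eq_shift[OF eqs(1)] shift_eq_shift[OF eqs(2)] True l
        have p: "p = map unpad (map fst (take (length p) z))"
          and q: "q = map unpad (map snd (take (length p) z))"
          and st: "s = map unpad (map fst (drop (length p) z)) @- blank"
            "t = map unpad (map snd (drop (length p) z)) @- blank"
          by (simp_all add: take_map drop_map)
        have "map repad p = map fst (take (length p) z)" "map repad q = map snd (take (length p) z)"
          by (subst p, simp add: comp_def) (subst q, simp add: comp_def)
        then have "w = take (length p) z" by (simp add: w_def zip_map_fst_snd)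
        with z(1) have "drop (length p) z \<in> {z. w @ z \<in> L}" by simp
        moreover have "x = unpad_pair (drop (length p) z)" by (simp add: x st unpad_pair_def)
        ultimately show ?thesis by blast
      next
        case False
        from shift_eq_shift(2)[OF eqs(1)[symmetric]] shift_eq_shift(2)[OF eqs(2)[symmetric]] False l
        have "drop (length z) p @- s = blank" "drop (length z) q @- t = blank"
          by simp_all
        then have "sdrop (length p - length z) (drop (length z) p @- s) = blank"
          "sdrop (length q - length z) (drop (length z) q @- t) = blank"
          by simp_all
        then have "s = blank" "t = blank" by (simp_all add: sdrop_shift)
        with False z x show ?thesis by (auto simp: D_def)
      qed
    next
      fix x assume "x \<in> unpad_pair ` {z. w @ z \<in> L} \<union> D"
      then show "x \<in> B"
      proof
        assume "x \<in> unpad_pair ` {z. w @ z \<in> L}"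
        then obtain z where z: "w @ z \<in> L" "x = unpad_pair z" by blast
        have "unpad_pair (w @ z) = (p @- fst x, q @- snd x)"
          unfolding z unpad_pair_def map_append w shift_append by simp
        with z(1) show "x \<in> B" unfolding B residual_def by (cases x) (auto intro: rev_image_eqI)
      next
        assume "x \<in> D"
        then show "x \<in> B" unfolding B residual_def D_def by (auto intro: rev_image_eqI)
      qed
    qed
    moreover have "{z. w @ z \<in> L} \<in> quotients L" by (auto simp: quotients_def)
    moreover have "D \<in> ?D" by (auto simp: D_def)
    ultimately show "B \<in> (\<lambda>(Z, D). unpad_pair ` Z \<union> D) ` (quotients L \<times> ?D)" by blast
  qed
  moreover have "finite ((\<lambda>(Z, D). unpad_pair ` Z \<union> D) ` (quotients L \<times> ?D))" using fin by simp
  ultimately show ?thesis unfolding regular_rel_def by (rule finite_subset)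
qed

section \<open>From pairs of streams back to padded paths over a finite graph\<close>

lemma arcs_free_semigroupoid_iff:
  assumes "wf_digraph X"
  shows "p \<in> arcs (free_semigroupoid X) \<longleftrightarrow>
    p \<noteq> [] \<and> set p \<subseteq> arcs X \<and> successively (\<lambda>e f. head X e = tail X f) p"
proof -
  interpret wf_digraph X by fact
  have cas: "cas (tail X (hd p)) p (head X (last p))" 
    if "successively (\<lambda>e f. head X e = tail X f) p" "p \<noteq> []" for p
    using that by (induction p rule: induct_list012) auto
  have cas': "successively (\<lambda>e f. head X e = tail X f) p" if "cas u p v" for u v
    using that by (induction p arbitrary: u rule: induct_list012) auto
  show ?thesis
  proof
    assume "p \<in> arcs (free_semigroupoid X)"
    then show "p \<noteq> [] \<and> set p \<subseteq> arcs X \<and> successively (\<lambda>e f. head X e = tail X f) p"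
      by (auto simp: free_semigroupoid_def awalk_def intro: cas')
  next
    assume p: "p \<noteq> [] \<and> set p \<subseteq> arcs X \<and> successively (\<lambda>e f. head X e = tail X f) p"
    then have "hd p \<in> arcs X" by (meson hd_in_set subsetD)
    with p cas[of p] have "awalk (tail X (hd p)) p (head X (last p))"
      by (auto simp: awalk_def)
    with p show "p \<in> arcs (free_semigroupoid X)" by (auto simp: free_semigroupoid_def)
  qed
qed

abbreviation padded_chain :: "('v, 'e) pre_digraph \<Rightarrow> ('v, 'e) padded_edge list \<Rightarrow> bool" where
  "padded_chain X \<equiv> successively (\<lambda>e f. head (padded_graph X) e = tail (padded_graph X) f)"

lemma padded_chain_pads:
  assumes "map unpad q @- blank = blank" "padded_chain X (e # q)"
  shows "q = replicate (length q) (Pad (head (padded_graph X) e))"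
  using assms
proof (induction q arbitrary: e)
  case (Cons f q)
  from Cons.prems(1) have "unpad f = None" and q: "map unpad q @- blank = blank"
    by simp_all
  then obtain v where f: "f = Pad v" by (cases f) auto
  from Cons.prems(2) have "v = head (padded_graph X) e" by (simp add: f padded_graph_def)
  moreover have "q = replicate (length q) (Pad (head (padded_graph X) f))"
    using Cons.IH[OF q, of f] Cons.prems(2) by simp
  ultimately show ?case by (simp add: f padded_graph_def)
qed simp

text \<open>\<open>unpad\<close> forgets at which vertex a pad sits. The chain condition restores
  this: pads are loops, so all of them sit at the target of the last proper edge.\<close>

lemma padded_chain_eq_pad_path:
  assumes "map unpad p @- blank = padded_stream u" "padded_chain X p" "u \<noteq> []"
  shows "length u \<le> length p \<and> p = pad_path X (length p) u"
  using assms
proof (induction u arbitrary: p)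
  case (Cons a u)
  from Cons.prems(1) obtain q where p: "p = Edge a # q"
    and q: "map unpad q @- blank = padded_stream u"
  proof (cases p)
    case (Cons x q)
    with Cons.prems(1) have "unpad x = Some a" "map unpad q @- blank = padded_stream u"
      by (simp_all add: padded_stream_Cons)
    then show ?thesis using that Cons by (cases x) auto
  qed (simp add: padded_stream_Cons)
  show ?case
  proof (cases "u = []")
    case True
    with q have "q = replicate (length q) (Pad (head (padded_graph X) (Edge a)))"
      using padded_chain_pads[of q X "Edge a"] Cons.prems(2) p by (simp add: padded_stream_Nil)
    then show ?thesis by (simp add: True p pad_path_def padded_graph_def)
  next
    case False
    have "padded_chain X q" using Cons.prems(2) by (auto simp: p successively_Cons)
    from Cons.IH[OF q this False] show ?thesis by (simp add: p pad_path_def False)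
  qed
qed simp

lemma padded_chain_pad_path:
  assumes "wf_digraph X" "u \<in> arcs (free_semigroupoid X)"
  shows "padded_chain X (pad_path X n u)"
    and "set (pad_path X n u) \<subseteq> arcs (padded_graph X)"
proof -
  from assms have u: "u \<noteq> []" "set u \<subseteq> arcs X" "successively (\<lambda>e f. head X e = tail X f) u"
    by (auto simp: arcs_free_semigroupoid_iff)
  have "padded_chain X (map Edge u)"
    using u(3) by (simp add: successively_map padded_graph_def)
  moreover have "padded_chain X (replicate k (Pad v))" for k v
    by (auto simp: successively_conv_nth padded_graph_def)
  ultimately show "padded_chain X (pad_path X n u)"
    using u(1) by (cases "n \<le> length u") (auto simp: hd_replicate pad_path_def successively_append_iff last_map padded_graph_def)
  have "last u \<in> arcs X" using u by auto
  then have "head X (last u) \<in> verts X"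
    using assms(1) by (rule wf_digraph.head_in_verts[rotated])
  with u(2) show "set (pad_path X n u) \<subseteq> arcs (padded_graph X)"
    by (auto simp: pad_path_def padded_graph_def)
qed

text \<open>The padded pairs of \<open>R\<close> are the words that form a path in the product
  graph, have no letter consisting of two pads, and unpad into \<open>R\<close>. The first two
  conditions look only at single letters and neighbours, and the third has finitely many quotients
  since \<open>R\<close> has finitely many residuals.\<close>

lemma synchronously_regularI:
  fixes X :: "('v, 'e) pre_digraph"
  assumes X: "wf_digraph X" "finite (verts X)" "finite (arcs X)"
    and R: "R \<subseteq> arcs (free_semigroupoid X) \<times> arcs (free_semigroupoid X)" "regular_rel R"
  shows "synchronously_regular X R"
proof -
  let ?G = "product_graph (padded_graph X) (padded_graph X)"
  let ?chain = "successively (\<lambda>e f. head ?G e = tail ?G f)"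
  \<comment> \<open>Excluding letters with two pads stops the padding exactly at the length of the
    longer path.\<close>
  define A where "A = arcs ?G - range Pad \<times> range Pad"
  have finA: "finite A" "finite (arcs ?G)"
    using X by (auto simp: A_def product_graph_def padded_graph_def)
  have chain: "?chain z \<longleftrightarrow> padded_chain X (map fst z) \<and> padded_chain X (map snd z)" for z
    by (induction z rule: induct_list012) (auto simp: product_graph_def)
  have L: "padded_pair X ` R = {z \<in> lists A. ?chain z} \<inter> {z. unpad_pair z \<in> padded_rel R}"
  proof (intro equalityI subsetI)
    fix z assume "z \<in> padded_pair X ` R"
    then obtain u v where uv: "(u, v) \<in> R" and z: "z = padded_pair X (u, v)" by auto
    define n where "n = max (length u) (length v)"
    have paths: "u \<in> arcs (free_semigroupoid X)" "v \<in> arcs (free_semigroupoid X)"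
      using R(1) uv by auto
    have comps: "map fst z = pad_path X n u" "map snd z = pad_path X n v"
      by (simp_all add: z padded_pair_components n_def)
    have "?chain z" unfolding chain comps by (simp add: padded_chain_pad_path X(1) paths)
    moreover have "z \<in> lists A"
      unfolding in_lists_conv_set
    proof
      fix e assume e: "e \<in> set z"
      then have "fst e \<in> set (map fst z)" "snd e \<in> set (map snd z)" by simp_all
      then have "e \<in> arcs ?G" unfolding comps
        using padded_chain_pad_path(2)[OF X(1) paths(1)] padded_chain_pad_path(2)[OF X(1) paths(2)]
        by (cases e) (auto simp: product_graph_def)
      moreover have "e \<notin> range Pad \<times> range Pad"
      proof
        assume pads: "e \<in> range Pad \<times> range Pad"
        from e obtain i where i: "i < length z" "z ! i = e" by (auto simp: in_set_conv_nth)
        have "length z = n" using length_pad_path[of u n X] comps(1) by (metis length_map max.cobounded1 n_def)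
        with i have "i < length u \<or> i < length v" by (auto simp: n_def)
        moreover have "fst e = pad_path X n u ! i" "snd e = pad_path X n v ! i"
          using i by (simp_all add: comps[symmetric])
        ultimately show False using pads
          by (auto simp: pad_path_def nth_append)
      qed
      ultimately show "e \<in> A" by (simp add: A_def)
    qed
    moreover have "unpad_pair z \<in> padded_rel R"
      using uv by (force simp: z unpad_pair_padded_pair padded_rel_def)
    ultimately show "z \<in> {z \<in> lists A. ?chain z} \<inter> {z. unpad_pair z \<in> padded_rel R}" by simp
  next
    fix z assume asm: "z \<in> {z \<in> lists A. ?chain z} \<inter> {z. unpad_pair z \<in> padded_rel R}"
    then obtain u v where uv: "(u, v) \<in> R" and "unpad_pair z = (padded_stream u, padded_stream v)"
      by (auto simp: padded_rel_def)
    then have eqs: "map unpad (map fst z) @- blank = padded_stream u"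
      "map unpad (map snd z) @- blank = padded_stream v"
      by (simp_all only: unpad_pair_def prod.inject)
    from R(1) uv have "u \<noteq> []" "v \<noteq> []" by (auto simp: arcs_free_semigroupoid_iff[OF X(1)])
    with eqs asm have u: "length u \<le> length z" "map fst z = pad_path X (length z) u"
      and v: "length v \<le> length z" "map snd z = pad_path X (length z) v"
      using padded_chain_eq_pad_path[of "map fst z" u X] padded_chain_eq_pad_path[of "map snd z" v X]
      by (simp_all add: chain)
    have "length z = max (length u) (length v)"
    proof (rule ccontr)
      assume "length z \<noteq> max (length u) (length v)"
      with u(1) v(1) have less: "length u < length z" "length v < length z" by auto
      define i where "i = length z - 1"
      have i: "length u \<le> i" "length v \<le> i" "i < length z" using less by (auto simp: i_def)
      have "fst (z ! i) = pad_path X (length z) u ! i" "snd (z ! i) = pad_path X (length z) v ! i"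
        using i by (simp_all flip: u(2) v(2))
      with i have "z ! i \<in> range Pad \<times> range Pad"
        by (cases "z ! i") (auto simp: pad_path_def nth_append)
      moreover have "z ! i \<in> A" using asm i(3) by (auto simp: in_lists_conv_set)
      ultimately show False by (simp add: A_def)
    qed
    then have "z = padded_pair X (u, v)"
      unfolding padded_pair_def Let_def prod.case using u(2) v(2) by (metis zip_map_fst_snd)
    with uv show "z \<in> padded_pair X ` R" by blast
  qed
  define T :: "(('v, 'e) padded_edge \<times> ('v, 'e) padded_edge) list set"
    where "T = {z. unpad_pair z \<in> padded_rel R}"
  have "quotients T \<subseteq>
    (\<lambda>B. {z. unpad_pair z \<in> B}) ` residuals (padded_rel R)"
  proof
    fix Z assume "Z \<in> quotients T"
    then obtain w where Z: "Z = {z. w @ z \<in> T}"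
      by (auto simp: quotients_def)
    define B where "B = residual (padded_rel R) (map unpad (map fst w)) (map unpad (map snd w))"
    have "B \<in> residuals (padded_rel R)"
      unfolding residuals_def B_def by (intro CollectI exI conjI, rule refl) simp
    moreover have "Z = {z. unpad_pair z \<in> B}"
      by (simp add: Z T_def B_def residual_def unpad_pair_def)
    ultimately show "Z \<in> (\<lambda>B. {z. unpad_pair z \<in> B}) ` residuals (padded_rel R)" by blast
  qed
  then have "finite (quotients (padded_pair X ` R))"
    unfolding L T_def[symmetric] using R(2)
    by (intro finite_quotients_Int finite_quotients_successively finA)
      (auto simp: regular_rel_def intro: finite_subset)
  moreover have "padded_pair X ` R \<subseteq> lists (arcs ?G)"
    unfolding L by (auto simp: A_def)
  ultimately show ?thesis
    unfolding synchronously_regular_def using R(1) finA(2) by (simp add: regular_languageI)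
qed


section \<open>The graph of generators of the semigroupoid\<close>

text \<open>
  The predecessor of a letter supplies the \<open>\<Lambda>\<close>-index of the matrix entry by which the letter is
  multiplied; \<open>to_nat\<close> is needed because edges are named by natural numbers.
\<close>

fun annotate :: "nat option \<Rightarrow> nat list \<Rightarrow> nat list" where
  "annotate k [] = []"
| "annotate k (a # u) = to_nat (k, a) # annotate (Some a) u"

lemma annotate_append:
  "annotate k (u @ v) = annotate k u @ annotate (if u = [] then k else Some (last u)) v"
  by (induction u arbitrary: k) auto

lemma annotate_eq_Nil_iff [simp]: "annotate k u = [] \<longleftrightarrow> u = []"
  by (cases u) auto

lemma annotate_inject [simp]: "annotate k u = annotate k v \<longleftrightarrow> u = v"
proof (induction u arbitrary: k v)
  case (Cons a u)
  then show ?case by (cases v) auto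
next
  case Nil
  then show ?case by (cases v) auto
qed

lemma take_annotate: "take n (annotate k u) = annotate k (take n u)"
  by (induction u arbitrary: k n) (auto simp: take_Cons split: nat.split)

text \<open>The annotation of a letter depends only on what precedes it, so cutting off a tail
  commutes with \<open>annotate\<close>.\<close>

lemma prefix_annotate_iff: "prefix w (annotate k u) \<longleftrightarrow> (\<exists>v. prefix v u \<and> w = annotate k v)"
proof
  assume "prefix w (annotate k u)"
  then have "w = take (length w) (annotate k u)" by (auto simp: prefix_def)
  then have "w = annotate k (take (length w) u)" by (simp add: take_annotate)
  with take_is_prefix show "\<exists>v. prefix v u \<and> w = annotate k v" by blast
qed (auto simp: prefix_def annotate_append)

lemma Pref_annotate: "Pref (annotate k ` L) = annotate k ` Pref L"
  by (auto simp: Pref_def prefix_annotate_iff)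

text \<open>A letter-to-letter transducer does this, its state being the previous letter. Finiteness
  of \<open>A\<close> bounds the number of states.\<close>

lemma regular_rel_annotate:
  assumes "finite A"
  shows "regular_rel {(u, annotate None u) |u. u \<in> lists A}"
proof -
  define R where "R k = {(u, annotate k u) |u. u \<in> lists A}" for k
  let ?C = "{{([], [])}, {}} \<union> R ` insert None (Some ` A)"
  have "regular_rel (R None)"
  proof (rule regular_relI[where C="?C"])
    fix B a b
    assume "B \<in> ?C"
    then consider "B \<in> {{([], [])}, {}}" | k where "B = R k" by blast
    then show "{(u, v). (a # u, b # v) \<in> B} \<in> ?C"
    proof cases
      case 2
      then have "{(u, v). (a # u, b # v) \<in> B} = (if a \<in> A \<and> b = to_nat (k, a) then R (Some a) else {})"
        by (auto simp: R_def)
      then show ?thesis by auto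
    qed auto
  next
    fix B and a :: nat
    assume "B \<in> ?C"
    then have "{(u, v). v = [] \<and> (a # u, []) \<in> B} = {}" by (auto simp: R_def)
    then show "{(u, v). v = [] \<and> (a # u, []) \<in> B} \<in> ?C" by blast
  next
    fix B and b :: nat
    assume "B \<in> ?C"
    then have "{(u, v). u = [] \<and> ([], b # v) \<in> B} = {}" by (auto simp: R_def)
    then show "{(u, v). u = [] \<and> ([], b # v) \<in> B} \<in> ?C" by blast
  next
    fix B :: "(nat list \<times> nat list) set"
    have "B \<inter> {([], [])} = {([], [])} \<or> B \<inter> {([], [])} = {}" by auto
    then show "B \<inter> {([], [])} \<in> ?C" by blast
  qed (use assms in auto)
  then show ?thesis by (simp add: R_def)
qed

section \<open>Regular relations supplied by the prefix-automatic structure of the Rees matrix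
  semigroup\<close>

locale rees_prefix_structure = rees_matrix_data S I \<Lambda> F G P
  for S :: "('o, 's) semigroupoid" and I :: "'i set" and \<Lambda> :: "'l set"
    and F :: "'i \<Rightarrow> 'o" and G :: "'l \<Rightarrow> 'o" and P :: "'l \<Rightarrow> 'i \<Rightarrow> 's option" +
  fixes X :: "(unit, nat) pre_digraph" and K :: "nat list set"
    and \<rho> :: "nat list \<Rightarrow> ('i \<times> 's \<times> 'l) option"
  assumes str: "prefix_automatic_structure (rees_matrix_semigroup S I \<Lambda> F G P) X K \<rho>"
begin

abbreviation "M \<equiv> rees_carrier S I \<Lambda> F G"
abbreviation "mul \<equiv> rees_mult S P"

definition words :: "nat list set" where
  "words = {u. u \<noteq> [] \<and> set u \<subseteq> arcs X}"

lemma M_iff: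
  "Some (i, x, l) \<in> M \<longleftrightarrow> i \<in> I \<and> x \<in> arcs S \<and> l \<in> \<Lambda> \<and> F i = tail S x \<and> head S x = G l"
  "None \<in> M"
  by (auto simp: rees_carrier_def)

lemma automatic: "automatic_structure (rees_matrix_semigroup S I \<Lambda> F G P) X K \<rho>"
  using str by (simp add: prefix_automatic_structure_def)

lemma choice: "choice_of_representatives (rees_matrix_semigroup S I \<Lambda> F G P) X K \<rho>"
  using automatic by (simp add: automatic_structure_def)

lemma wf_X: "wf_digraph X"
  using choice by (simp add: choice_of_representatives_def)

lemma finite_X: "finite (arcs X)"
  using automatic by (simp add: automatic_structure_def)

lemma words_eq: "arcs (free_semigroupoid X) = words"
  by (auto simp: words_def arcs_free_semigroupoid_iff[OF wf_X] successively_conv_nth)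

lemma rho_in: "u \<in> words \<Longrightarrow> \<rho> u \<in> M"
  using choice by (auto simp: choice_of_representatives_def words_eq rees_matrix_semigroup_def one_object_def)

lemma rho_append: "u \<in> words \<Longrightarrow> v \<in> words \<Longrightarrow> \<rho> (u @ v) = mul (\<rho> u) (\<rho> v)"
proof -
  have "\<forall>e\<in>words. \<forall>f\<in>words. \<rho> (e @ f) = mul (\<rho> e) (\<rho> f)"
    using choice unfolding choice_of_representatives_def semigroupoid_hom_def words_eq
    by (simp add: rees_matrix_semigroup_def one_object_def free_semigroupoid_def)
  then show "u \<in> words \<Longrightarrow> v \<in> words \<Longrightarrow> \<rho> (u @ v) = mul (\<rho> u) (\<rho> v)" by blast
qed

lemma K_words: "K \<subseteq> words"
  using choice by (simp add: choice_of_representatives_def words_eq)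

lemma K_surj: "m \<in> M \<Longrightarrow> \<exists>u\<in>K. \<rho> u = m"
proof -
  have "\<rho> ` K = M"
    using choice by (simp add: choice_of_representatives_def rees_matrix_semigroup_def one_object_def)
  then show "m \<in> M \<Longrightarrow> \<exists>u\<in>K. \<rho> u = m" by (metis imageE)
qed

lemma mul_closed: "a \<in> M \<Longrightarrow> b \<in> M \<Longrightarrow> mul a b \<in> M"
  and mul_assoc: "a \<in> M \<Longrightarrow> b \<in> M \<Longrightarrow> c \<in> M \<Longrightarrow> mul a (mul b c) = mul (mul a b) c"
  using semigroupoid.mult_closed[OF semigroupoid_rees_matrix_semigroup, of a b]
    semigroupoid.mult_assoc[OF semigroupoid_rees_matrix_semigroup, of a b c]
  by (simp_all add: rees_matrix_semigroup_def one_object_def)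

lemma Pref_words: "Pref K \<subseteq> words"
  using K_words set_mono_prefix by (fastforce simp: Pref_def words_def)

lemma Pref_snoc: "u @ [a] \<in> Pref K \<Longrightarrow> u \<noteq> [] \<Longrightarrow> u \<in> Pref K"
  by (auto simp: Pref_def dest: append_prefixD)

lemma regular_vertex: "regular_rel {(u, v) \<in> K \<times> K. \<rho> u = \<rho> v}"
proof -
  have "() \<in> verts X"
    using choice by (simp add: choice_of_representatives_def rees_matrix_semigroup_def one_object_def)
  then have "synchronously_regular X (vertex_relation X K \<rho> ())"
    using automatic by (simp add: automatic_structure_def)
  then show ?thesis
    using regular_rel_if_synchronously_regular by (fastforce simp: vertex_relation_def)
qed

lemma regular_prefix: "regular_rel {(u, v) \<in> K \<times> Pref K. \<rho> u = \<rho> v}"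
  using str regular_rel_if_synchronously_regular by (auto simp: prefix_automatic_structure_def)

definition mul_rel :: "('i \<times> 's \<times> 'l) option \<Rightarrow> (nat list \<times> nat list) set" where
  "mul_rel e = {(u, v) \<in> K \<times> K. mul (\<rho> u) e = \<rho> v}"

text \<open>Writing \<open>e\<close> as the value of a word turns multiplication by \<open>e\<close>
  into successive multiplications by generators, whose relations are composed.\<close>

lemma regular_mul_rel:
  assumes "e \<in> M"
  shows "regular_rel (mul_rel e)"
proof -
  have edge: "regular_rel (mul_rel (\<rho> [b]))" if "b \<in> arcs X" for b
  proof -
    have "synchronously_regular X (edge_relation X K \<rho> b)"
      using automatic that by (simp add: automatic_structure_def)
    moreover have "edge_relation X K \<rho> b = mul_rel (\<rho> [b])"
      using K_words that
      by (auto simp: edge_relation_def mul_rel_def rho_append words_def)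
    ultimately show ?thesis using regular_rel_if_synchronously_regular by metis
  qed
  have "regular_rel (mul_rel (\<rho> p))" if "p \<noteq> []" "p \<in> words" for p
    using that
  proof (induction p rule: rev_nonempty_induct)
    case (single b)
    then show ?case by (auto simp: words_def intro: edge)
  next
    case (snoc b p)
    then have p: "p \<in> words" and b: "b \<in> arcs X" "[b] \<in> words" by (auto simp: words_def)
    have eq: "mul (\<rho> u) (\<rho> (p @ [b])) = mul (mul (\<rho> u) (\<rho> p)) (\<rho> [b])" if "u \<in> K" for u
      using that p b K_words by (simp add: rho_append mul_assoc rho_in subset_iff)
    have "mul_rel (\<rho> (p @ [b])) = mul_rel (\<rho> p) O mul_rel (\<rho> [b])"
    proof (intro equalityI subsetI)
      fix x assume "x \<in> mul_rel (\<rho> (p @ [b]))"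
      then obtain u v where x: "x = (u, v)" and u: "u \<in> K" and v: "v \<in> K"
        and *: "mul (\<rho> u) (\<rho> (p @ [b])) = \<rho> v"
        by (auto simp: mul_rel_def)
      have "mul (\<rho> u) (\<rho> p) \<in> M" using K_words u p by (auto intro!: mul_closed rho_in)
      \<comment> \<open>The intermediate product has a representative in \<open>K\<close> because
        \<open>K\<close> maps onto the whole semigroup.\<close>
      then obtain w where "w \<in> K" "\<rho> w = mul (\<rho> u) (\<rho> p)" using K_surj by blast
      then show "x \<in> mul_rel (\<rho> p) O mul_rel (\<rho> [b])"
        using u v * eq[OF u] x by (auto simp: mul_rel_def relcomp_unfold)
    qed (auto simp: mul_rel_def eq)
    with snoc edge[OF b(1)] p show ?case by (simp add: regular_rel_relcomp)
  qed
  moreover obtain u where "u \<in> K" "\<rho> u = e" using K_surj[OF assms] by blast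
  ultimately show ?thesis using K_words by (auto simp: words_def)
qed

definition K_nonzero :: "nat list set" where
  "K_nonzero = {u \<in> K. \<rho> u \<noteq> None}"

text \<open>Zero has a representative \<open>z\<close> in \<open>K\<close>. The words of value zero
  are those related to \<open>z\<close> by equality of values, and they can be subtracted from
  \<open>K\<close>.\<close>

lemma regular_K_nonzero: "regular_rel (Id_on K_nonzero)"
proof -
  let ?V = "{(u, v) \<in> K \<times> K. \<rho> u = \<rho> v}"
  obtain z where z: "z \<in> K" "\<rho> z = None" using K_surj[OF M_iff(2)] by blast
  have "Domain ?V = K" by auto
  moreover have "Domain (?V O {(z, z)}) = {u \<in> K. \<rho> u = None}"
    using z by (auto simp: relcomp_unfold)
  ultimately have "Id_on K_nonzero = Id_on (Domain ?V) - Id_on (Domain (?V O {(z, z)}))"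
    by (auto simp: K_nonzero_def)
  then show ?thesis
    by (simp only:) (intro regular_rel_Diff regular_rel_Domain regular_rel_relcomp
        regular_rel_singleton regular_vertex)
qed

text \<open>The value of \<open>v\<close> is that of \<open>u\<close> with the final generator
  \<open>a\<close> replaced by the element \<open>e\<close>. One-letter words are listed separately
  because the empty word has no value.\<close>

definition last_mul_rel :: "nat \<Rightarrow> ('i \<times> 's \<times> 'l) option \<Rightarrow> (nat list \<times> nat list) set" where
  "last_mul_rel a e = {(u, v). u \<in> Pref K \<and> v \<in> K_nonzero \<and>
     (u = [a] \<and> \<rho> v = e \<or> (\<exists>u'. u = u' @ [a] \<and> u' \<noteq> [] \<and> mul (\<rho> u') e = \<rho> v))}"

text \<open>
  This is where prefix-automaticity enters: the word without its last letter need not belong to \<open>K\<close>,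
  but it is a prefix of a word of \<open>K\<close>, so it can be replaced by a representative.
\<close>

lemma regular_last_mul_rel:
  assumes "e \<in> M"
  shows "regular_rel (last_mul_rel a e)"
proof -
  let ?V = "{(u, v) \<in> K \<times> K. \<rho> u = \<rho> v}"
  let ?Q = "{(u, v) \<in> K \<times> Pref K. \<rho> u = \<rho> v}"
  obtain k where k: "k \<in> K" "\<rho> k = e" using K_surj[OF assms] by blast
  have *: "\<exists>w\<in>K. \<rho> w = \<rho> u" if "u \<in> Pref K" for u
    using that Pref_words K_surj rho_in by blast
  \<comment> \<open>Every prefix has a value and hence a representative in \<open>K\<close>, so
    regularity of \<open>Pref K\<close> is read off from the prefix relation.\<close>
  have "Domain (?Q\<inverse>) = Pref K"
    using * by auto
  then have PrefK: "regular_rel (Id_on (Pref K))"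
    using regular_rel_Domain[OF regular_rel_converse[OF regular_prefix]] by simp
  have "last_mul_rel a e = Id_on (Pref K) O ({([a], k)} O ?V \<union>
    {(u @ [a], u) |u. True} O ?Q\<inverse> O mul_rel e) O Id_on K_nonzero" (is "_ = ?R")
  proof (intro equalityI subsetI)
    fix x assume "x \<in> last_mul_rel a e"
    then obtain u v where x: "x = (u, v)" and u: "u \<in> Pref K" and v: "v \<in> K_nonzero" "v \<in> K"
      and "u = [a] \<and> \<rho> v = e \<or> (\<exists>u'. u = u' @ [a] \<and> u' \<noteq> [] \<and> mul (\<rho> u') e = \<rho> v)"
      by (auto simp: last_mul_rel_def K_nonzero_def)
    then consider "u = [a]" "\<rho> v = e"
      | u' where "u = u' @ [a]" "u' \<noteq> []" "mul (\<rho> u') e = \<rho> v" by blast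
    then show "x \<in> ?R"
    proof cases
      case 1
      then have "(u, v) \<in> {([a], k)} O ?V" using k v by auto
      then show ?thesis using x u v(1) by blast
    next
      case 2
      then have "u' \<in> Pref K" using u Pref_snoc by blast
      with * obtain w where "w \<in> K" "\<rho> w = \<rho> u'" by blast
      then have "(u', w) \<in> ?Q\<inverse>" "(w, v) \<in> mul_rel e"
        using \<open>u' \<in> Pref K\<close> v 2 by (auto simp: mul_rel_def)
      then show ?thesis using x u v(1) 2(1) by blast
    qed
  next
    fix x assume "x \<in> ?R"
    then show "x \<in> last_mul_rel a e"
      using k by (auto simp: last_mul_rel_def mul_rel_def Pref_def)
  qed
  then show ?thesis
    by (simp only:) (intro regular_rel_relcomp regular_rel_Un regular_rel_singleton
        regular_rel_converse PrefK regular_vertex regular_prefix regular_rel_snoc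
        regular_mul_rel assms regular_K_nonzero)
qed

section \<open>Nonzero generators as triples, and the outer indices of nonzero words\<close>

definition letters :: "nat set" where
  "letters = {a \<in> arcs X. \<rho> [a] \<noteq> None}"

definition row :: "nat \<Rightarrow> 'i" where "row a = fst (the (\<rho> [a]))"
definition entry :: "nat \<Rightarrow> 's" where "entry a = fst (snd (the (\<rho> [a])))"
definition col :: "nat \<Rightarrow> 'l" where "col a = snd (snd (the (\<rho> [a])))"

lemma finite_letters: "finite letters"
  using finite_X by (simp add: letters_def)

lemma rho_letter: "a \<in> letters \<Longrightarrow> \<rho> [a] = Some (row a, entry a, col a)"
  by (auto simp: letters_def row_def entry_def col_def)

lemma letter_in_M:
  assumes "a \<in> letters"
  shows "row a \<in> I" "entry a \<in> arcs S" "col a \<in> \<Lambda>" "F (row a) = tail S (entry a)"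
    "head S (entry a) = G (col a)"
proof -
  have "Some (row a, entry a, col a) \<in> M"
    using rho_in[of "[a]"] assms rho_letter[OF assms] by (simp add: letters_def words_def)
  then show "row a \<in> I" "entry a \<in> arcs S" "col a \<in> \<Lambda>" "F (row a) = tail S (entry a)"
    "head S (entry a) = G (col a)"
    by (simp_all add: M_iff)
qed

lemma rho_snoc_Some:
  assumes "u \<in> words" "a \<in> arcs X" "\<rho> (u @ [a]) = Some (i, x, l)"
  obtains x' l' p where "\<rho> u = Some (i, x', l')" "a \<in> letters" "P l' (row a) = Some p"
    "x = mult S (mult S x' p) (entry a)" "l = col a"
proof -
  have "\<rho> (u @ [a]) = mul (\<rho> u) (\<rho> [a])" using assms by (simp add: rho_append words_def)
  with assms(3) have *: "mul (\<rho> u) (\<rho> [a]) = Some (i, x, l)" by simp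
  then have a: "a \<in> letters" using assms(2) by (cases "\<rho> u"; cases "\<rho> [a]") (auto simp: letters_def)
  from * obtain i' x' l' where u: "\<rho> u = Some (i', x', l')" by (cases "\<rho> u") auto
  from * that a u show ?thesis by (auto simp: rho_letter split: option.splits)
qed

text \<open>Zero is absorbing, so a nonzero word has only nonzero letters; a nonzero product keeps
  the row of its first factor and the column of its last.\<close>

lemma rho_ends:
  assumes "u \<in> words" "\<rho> u = Some (i, x, l)"
  shows "hd u \<in> letters" "i = row (hd u)" "last u \<in> letters" "l = col (last u)"
proof -
  have "u \<noteq> []" using assms(1) by (simp add: words_def)
  then have "hd u \<in> letters \<and> i = row (hd u) \<and> last u \<in> letters \<and> l = col (last u)"
    using assms
  proof (induction u arbitrary: x l rule: rev_nonempty_induct)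
    case (single a)
    then have "a \<in> letters" by (auto simp: letters_def words_def)
    with single show ?case by (simp add: rho_letter)
  next
    case (snoc a u)
    then have "u \<in> words" "a \<in> arcs X" by (auto simp: words_def)
    from rho_snoc_Some[OF this snoc.prems(2)] snoc.IH[OF this(1)] snoc.hyps show ?case
      by (metis hd_append2 last_snoc)
  qed
  then show "hd u \<in> letters" "i = row (hd u)" "last u \<in> letters" "l = col (last u)" by blast+
qed

text \<open>The matrix entry between two neighbours is absorbed into the right one. An arrow
  labelled by \<open>Some b\<close> and \<open>a\<close> thus runs from \<open>G (col b)\<close> to
  \<open>G (col a)\<close>, so that consecutive annotated letters compose. \<open>None\<close> marks
  pairs giving no arrow.\<close>

definition label :: "nat option \<Rightarrow> nat \<Rightarrow> 's option" where
  "label k a = (if a \<notin> letters then None else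
     case k of None \<Rightarrow> Some (entry a)
     | Some b \<Rightarrow> if b \<notin> letters then None else
         map_option (\<lambda>p. mult S p (entry a)) (P (col b) (row a)))"

definition val :: "nat \<Rightarrow> 's" where
  "val c = (case from_nat c of (k, a) \<Rightarrow> the (label k a))"

definition Y :: "('o, nat) pre_digraph" where
  "Y = \<lparr>verts = verts S, arcs = {to_nat (k, a) |k a. label k a \<noteq> None},
     tail = (\<lambda>c. tail S (val c)), head = (\<lambda>c. head S (val c))\<rparr>"

lemma val_to_nat: "label k a = Some s \<Longrightarrow> val (to_nat (k, a)) = s"
  by (simp add: val_def)

lemma label_Some:
  assumes "label k a = Some s"
  shows "s \<in> arcs S" "head S s = G (col a)" "a \<in> letters"
    "k = Some b \<Longrightarrow> tail S s = G (col b) \<and> b \<in> letters"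
proof -
  show a: "a \<in> letters" using assms by (auto simp: label_def split: if_splits)
  have "s \<in> arcs S \<and> head S s = G (col a) \<and> (\<forall>b. k = Some b \<longrightarrow> tail S s = G (col b) \<and> b \<in> letters)"
  proof (cases k)
    case None
    with assms a letter_in_M[OF a] show ?thesis by (simp add: label_def)
  next
    case (Some b)
    with assms a obtain p where b: "b \<in> letters" and p: "P (col b) (row a) = Some p"
      and s: "s = mult S p (entry a)"
      by (auto simp: label_def split: if_splits)
    from P_entries[OF letter_in_M(3)[OF b] letter_in_M(1)[OF a] p] letter_in_M[OF a] b
    show ?thesis by (simp add: s Some mult_closed head_mult tail_mult)
  qed
  then show "s \<in> arcs S" "head S s = G (col a)" "k = Some b \<Longrightarrow> tail S s = G (col b) \<and> b \<in> letters"
    by blast+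
qed

lemma finite_Y: "finite (arcs Y)"
proof -
  have "arcs Y \<subseteq> to_nat ` (insert None (Some ` letters) \<times> letters)"
  proof
    fix c assume "c \<in> arcs Y"
    then obtain k a s where c: "c = to_nat (k, a)" and s: "label k a = Some s" by (auto simp: Y_def)
    from label_Some[OF s] have "(k, a) \<in> insert None (Some ` letters) \<times> letters" by (cases k) auto
    then show "c \<in> to_nat ` (insert None (Some ` letters) \<times> letters)" using c by blast
  qed
  then show ?thesis using finite_letters by (meson finite_SigmaI finite_imageI finite_insert finite_subset)
qed

lemma val_in: "c \<in> arcs Y \<Longrightarrow> val c \<in> arcs S"
  using label_Some(1) by (auto simp: Y_def val_to_nat)

lemma ends_in_verts: "x \<in> arcs S \<Longrightarrow> tail S x \<in> verts S" "x \<in> arcs S \<Longrightarrow> head S x \<in> verts S"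
  using graph by (auto simp: wf_digraph_def pre_digraph.truncate_def)

lemma wf_Y: "wf_digraph Y"
proof
  fix c assume "c \<in> arcs Y"
  from val_in[OF this] show "tail Y c \<in> verts Y" "head Y c \<in> verts Y"
    by (simp_all add: Y_def ends_in_verts)
qed

section \<open>Evaluation of paths in \<open>S\<close> and its agreement with
  \<open>\<rho>\<close>\<close>

fun eval :: "nat list \<Rightarrow> 's" where
  "eval [] = undefined"
| "eval [c] = val c"
| "eval (c # d # w) = mult S (val c) (eval (d # w))"

abbreviation "paths \<equiv> arcs (free_semigroupoid Y)"

lemmas paths_iff = arcs_free_semigroupoid_iff[OF wf_Y]

lemma eval_path:
  assumes "w \<in> paths"
  shows "eval w \<in> arcs S" "tail S (eval w) = tail Y (hd w)" "head S (eval w) = head Y (last w)"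
proof -
  from assms have "w \<noteq> []" "set w \<subseteq> arcs Y" "successively (\<lambda>e f. head Y e = tail Y f) w"
    by (simp_all add: paths_iff)
  then have "eval w \<in> arcs S \<and> tail S (eval w) = tail Y (hd w) \<and> head S (eval w) = head Y (last w)"
  proof (induction w rule: eval.induct)
    case (2 c)
    then show ?case by (simp add: val_in) (simp add: Y_def)
  next
    case (3 c d w)
    then have "eval (d # w) \<in> arcs S" "tail S (eval (d # w)) = head S (val c)" "val c \<in> arcs S"
      "tail Y c = tail S (val c)" "head S (eval (d # w)) = head Y (last (d # w))"
      by (simp_all add: val_in) (simp_all add: Y_def)
    then show ?case by (simp add: mult_closed tail_mult head_mult)
  qed simp
  then show "eval w \<in> arcs S" "tail S (eval w) = tail Y (hd w)" "head S (eval w) = head Y (last w)"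
    by blast+
qed

lemma paths_append:
  "w \<in> paths \<Longrightarrow> w' \<in> paths \<Longrightarrow> head Y (last w) = tail Y (hd w') \<Longrightarrow> w @ w' \<in> paths"
  by (auto simp: paths_iff successively_append_iff)

lemma eval_append:
  assumes "w \<in> paths" "w' \<in> paths" "head Y (last w) = tail Y (hd w')"
  shows "eval (w @ w') = mult S (eval w) (eval w')"
proof -
  have "w \<noteq> []" using assms(1) by (simp add: paths_iff)
  then show ?thesis using assms
  proof (induction w rule: eval.induct)
    case (2 c)
    then show ?case by (cases w') (auto simp: paths_iff)
  next
    case (3 c d w)
    have dw: "d # w \<in> paths" and c: "c \<in> arcs Y" and cd: "head Y c = tail Y d"
      using 3(3) by (auto simp: paths_iff)
    have IH: "eval ((d # w) @ w') = mult S (eval (d # w)) (eval w')" using 3 dw by simp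
    have "mult S (val c) (mult S (eval (d # w)) (eval w')) =
      mult S (mult S (val c) (eval (d # w))) (eval w')"
      using eval_path[OF dw] eval_path[OF 3(4)] val_in[OF c] cd 3(5)
      by (intro mult_assoc) (simp_all add: Y_def)
    with IH show ?case by simp
  qed simp
qed

text \<open>Appending \<open>a\<close> multiplies the middle component by a matrix entry and
  \<open>entry a\<close>. The column selecting that entry belongs to the last letter read, which is
  just what the annotation remembers.\<close>

lemma annotate_path:
  assumes "u \<in> words" "\<rho> u = Some (i, x, l)"
  shows "annotate None u \<in> paths" "eval (annotate None u) = x"
proof -
  have "u \<noteq> []" using assms(1) by (simp add: words_def)
  then have "annotate None u \<in> paths \<and> eval (annotate None u) = x"
    using assms
  proof (induction u arbitrary: x l rule: rev_nonempty_induct)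
    case (single a)
    then have a: "a \<in> letters" by (auto simp: letters_def words_def)
    then have "label None a = Some (entry a)" by (simp add: label_def)
    then have "to_nat (None :: nat option, a) \<in> arcs Y" by (auto simp: Y_def)
    with single a \<open>label None a = Some (entry a)\<close> show ?case
      by (simp add: rho_letter paths_iff val_to_nat)
  next
    case (snoc a u)
    then have u: "u \<in> words" and aX: "a \<in> arcs X" by (auto simp: words_def)
    obtain x' l' p where \<rho>u: "\<rho> u = Some (i, x', l')" and a: "a \<in> letters"
      and p: "P l' (row a) = Some p" and x: "x = mult S (mult S x' p) (entry a)"
      using rho_snoc_Some[OF u aX snoc.prems(2)] by metis
    have IH: "annotate None u \<in> paths" "eval (annotate None u) = x'"
      using snoc.IH[OF u \<rho>u] by blast+
    note last = rho_ends(3,4)[OF u \<rho>u]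
    define c where "c = to_nat (Some (last u), a)"
    have lab: "label (Some (last u)) a = Some (mult S p (entry a))"
      using a last p by (simp add: label_def)
    have c: "c \<in> arcs Y" "val c = mult S p (entry a)"
      using lab by (auto simp: c_def Y_def val_to_nat)
    have x': "x' \<in> arcs S" "head S x' = G l'" "l' \<in> \<Lambda>"
      using rho_in[OF u] \<rho>u by (simp_all add: M_iff)
    have p': "p \<in> arcs S" "tail S p = G l'" "head S p = tail S (entry a)"
      using P_entries[OF x'(3) letter_in_M(1)[OF a] p] letter_in_M[OF a] by simp_all
    have hd: "head Y (last (annotate None u)) = tail Y c"
      using eval_path(3)[OF IH(1)] IH(2) x' p' letter_in_M[OF a]
      by (simp add: Y_def c(2) tail_mult)
    have "[c] \<in> paths" using c(1) by (simp add: paths_iff)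
    with hd paths_append[OF IH(1) this] eval_append[OF IH(1) this] snoc.hyps
    show ?case
      using x' p' letter_in_M[OF a]
      by (simp add: annotate_append c_def[symmetric] c(2) IH(2) x mult_assoc)
  qed
  then show "annotate None u \<in> paths" "eval (annotate None u) = x" by blast+
qed

text \<open>
  Fixing a row for every object makes the row of a representative a function of its value in \<open>S\<close>.
\<close>

definition base_row :: "'o \<Rightarrow> 'i" where
  "base_row v = (SOME i. i \<in> I \<and> F i = v)"

definition K_based :: "nat list set" where
  "K_based = {u \<in> K. \<exists>i x l. \<rho> u = Some (i, x, l) \<and> i = base_row (F i)}"

lemma base_row: "x \<in> arcs S \<Longrightarrow> base_row (tail S x) \<in> I \<and> F (base_row (tail S x)) = tail S x"
  unfolding base_row_def by (rule someI_ex) (use F_surj in \<open>metis imageE imageI\<close>)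

text \<open>The row of a nonzero word is the row of its first letter, so being based is a test on
  that letter.\<close>

lemma regular_K_based: "regular_rel (Id_on K_based)"
proof -
  have "u \<in> K_based \<longleftrightarrow> u \<in> K_nonzero \<and>
    u \<noteq> [] \<and> hd u \<in> {a. row a = base_row (F (row a))}" for u
  proof (cases "u \<in> K \<and> \<rho> u \<noteq> None")
    case True
    then obtain i x l where "\<rho> u = Some (i, x, l)" "u \<in> K" "u \<in> words" using K_words by auto
    with rho_ends[of u i x l] show ?thesis by (auto simp: K_based_def K_nonzero_def words_def)
  qed (auto simp: K_based_def K_nonzero_def)
  then have "Id_on K_based = Id_on K_nonzero \<inter>
    Id_on {u. u \<noteq> [] \<and> hd u \<in> {a. row a = base_row (F (row a))}}"
    by (auto simp: Id_on_iff)
  then show ?thesis by (simp only: regular_rel_Int regular_K_nonzero regular_rel_hd)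
qed

lemma K_based_Pref: "K_based \<subseteq> Pref K_based"
  using K_words by (fastforce simp: K_based_def Pref_def words_def)

text \<open>A prefix of a nonzero word is nonzero because zero is absorbing, and it shares the first
  letter and hence the row.\<close>

lemma Pref_K_based:
  assumes "u \<in> Pref K_based"
  obtains i x l where "u \<in> Pref K" "u \<in> words" "\<rho> u = Some (i, x, l)" "i = base_row (F i)"
proof -
  from assms obtain w i x l where w: "w \<in> K" "prefix u w" "\<rho> w = Some (i, x, l)" "i = base_row (F i)"
    and "u \<noteq> []"
    by (auto simp: Pref_def K_based_def)
  then have u: "u \<in> Pref K" "u \<in> words" using Pref_words by (auto simp: Pref_def)
  from w(2) obtain t where t: "w = u @ t" by (auto simp: prefix_def)
  have "w \<in> words" using w(1) K_words by blast
  have "\<rho> u \<noteq> None"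
  proof (cases "t = []")
    case False
    then have "t \<in> words" using \<open>w \<in> words\<close> by (auto simp: words_def t)
    with u(2) w(3) show ?thesis by (cases "\<rho> u") (auto simp: t rho_append)
  qed (use t w(3) in simp)
  then obtain i' x' l' where \<rho>u: "\<rho> u = Some (i', x', l')" by auto
  have "hd w = hd u" using \<open>u \<noteq> []\<close> by (simp add: t)
  then have "i' = i"
    using rho_ends(2)[OF u(2) \<rho>u] rho_ends(2)[OF \<open>w \<in> words\<close> w(3)] by simp
  with that u \<rho>u w(4) show ?thesis by blast
qed

lemma K_based_Some:
  assumes "u \<in> K_based"
  obtains i x l where "u \<in> K" "u \<in> words" "\<rho> u = Some (i, x, l)" "i = base_row (F i)"
  using assms K_words by (auto simp: K_based_def)

lemma annotate_Pref_K_based: "u \<in> Pref K_based \<Longrightarrow> annotate None u \<in> paths"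
  by (erule Pref_K_based) (rule annotate_path)

text \<open>An arrow \<open>x\<close> is reached as the middle component of a triple with row
  \<open>base_row (tail S x)\<close> and any column \<open>l\<close> satisfying
  \<open>G l = head S x\<close>.\<close>

lemma choice_Y: "choice_of_representatives S Y (annotate None ` K_based) eval"
proof -
  have hom: "semigroupoid_hom (free_semigroupoid Y) S id eval"
    unfolding semigroupoid_hom_def
  proof (intro conjI ballI impI)
    fix v assume "v \<in> verts (free_semigroupoid Y)"
    then show "id v \<in> verts S" by (simp add: free_semigroupoid_def Y_def)
  next
    fix e assume "e \<in> paths"
    from eval_path[OF this] show "eval e \<in> arcs S"
      "tail S (eval e) = id (tail (free_semigroupoid Y) e)"
      "head S (eval e) = id (head (free_semigroupoid Y) e)"
      by (simp_all add: free_semigroupoid_def)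
  next
    fix e f assume "e \<in> paths" "f \<in> paths" "head (free_semigroupoid Y) e = tail (free_semigroupoid Y) f"
    then show "eval (mult (free_semigroupoid Y) e f) = mult S (eval e) (eval f)"
      using eval_append by (simp add: free_semigroupoid_def)
  qed
  have sub: "annotate None ` K_based \<subseteq> paths"
    using annotate_Pref_K_based K_based_Pref by blast
  have surj: "x \<in> eval ` annotate None ` K_based" if "x \<in> arcs S" for x
  proof -
    have "head S x \<in> G ` \<Lambda>" using that by (auto simp: G_surj)
    then obtain l where "l \<in> \<Lambda>" "head S x = G l" by blast
    with base_row[OF that] that have "Some (base_row (tail S x), x, l) \<in> M" by (simp add: M_iff)
    from K_surj[OF this] obtain u where u: "u \<in> K" "\<rho> u = Some (base_row (tail S x), x, l)" by blast
    then have "u \<in> K_based" using base_row[OF that] by (simp add: K_based_def)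
    moreover have "eval (annotate None u) = x"
      using u K_words annotate_path(2) by blast
    ultimately show ?thesis by blast
  qed
  have "eval ` paths \<subseteq> arcs S" using eval_path(1) by blast
  moreover have "arcs S \<subseteq> eval ` annotate None ` K_based" using surj by blast
  moreover have "eval ` annotate None ` K_based \<subseteq> eval ` paths" using sub by (rule image_mono)
  ultimately have "eval ` paths = arcs S" "eval ` annotate None ` K_based = arcs S" by simp_all
  then show ?thesis
    unfolding choice_of_representatives_def using wf_Y hom sub by (simp add: Y_def)
qed

text \<open>By isolation-freeness every object is an end of some arrow. That arrow is the middle
  component of a word, so its ends are ends of the entries of the first and last letters, and there
  are finitely many letters.\<close>

lemma finite_verts: "finite (verts S)"
proof -
  have "v \<in> tail S ` entry ` letters \<union> head S ` entry ` letters" if v: "v \<in> verts S" for v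
  proof -
    have *: "tail S x \<in> tail S ` entry ` letters \<and> head S x \<in> head S ` entry ` letters"
      if x: "x \<in> arcs S" for x
    proof -
      obtain i where i: "i \<in> I" "F i = tail S x" using base_row[OF x] by blast
      have "head S x \<in> G ` \<Lambda>" using x by (auto simp: G_surj)
      then obtain l where "l \<in> \<Lambda>" "head S x = G l" by blast
      with i x have "Some (i, x, l) \<in> M" by (simp add: M_iff)
      from K_surj[OF this] obtain u where "u \<in> words" "\<rho> u = Some (i, x, l)" using K_words by blast
      from rho_ends[OF this] letter_in_M i \<open>head S x = G l\<close> show ?thesis by (metis imageI)
    qed
    obtain x where "x \<in> arcs S" "tail S x = v \<or> head S x = v"
      using isolation_free v by (auto simp: isolation_free_def)
    with * show ?thesis by blast
  qed
  then show ?thesis using finite_letters by (meson finite_UnI finite_imageI finite_subset subsetI)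
qed

section \<open>Right multiplication by an optional arrow, transferred to the last letter of a
  word\<close>

definition act :: "'s option \<Rightarrow> 's \<Rightarrow> 's" where
  "act g x = (case g of None \<Rightarrow> x | Some s \<Rightarrow> mult S x s)"

lemma act_mult:
  assumes "x \<in> arcs S" "y \<in> arcs S" "head S x = tail S y" "\<forall>s. g = Some s \<longrightarrow> s \<in> arcs S \<and> tail S s = head S y"
  shows "act g (mult S x y) = mult S x (act g y)"
  using assms by (cases g) (auto simp: act_def mult_assoc)

lemma act_in:
  assumes "y \<in> arcs S" "\<forall>s. g = Some s \<longrightarrow> s \<in> arcs S \<and> tail S s = head S y"
  shows "act g y \<in> arcs S" "tail S (act g y) = tail S y"
    "head S (act g y) = (case g of None \<Rightarrow> head S y | Some s \<Rightarrow> head S s)"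
  using assms by (cases g; auto simp: act_def mult_closed tail_mult head_mult)+

text \<open>If \<open>x\<close> is \<open>x' p\<close> times the entry of the last letter,
  associativity moves the factor \<open>g\<close> onto that entry. Multiplying by \<open>g\<close>
  thus amounts to replacing the last generator.\<close>

lemma last_mul_rel_iff:
  assumes u: "u \<in> Pref K" "\<rho> u = Some (i, x, l)" and v: "v \<in> K"
    and g: "\<forall>s. g = Some s \<longrightarrow> s \<in> arcs S \<and> tail S s = head S x"
  shows "(u, v) \<in> last_mul_rel (last u) (Some (row (last u), act g (entry (last u)), m)) \<longleftrightarrow>
    \<rho> v = Some (i, act g x, m)"
proof -
  have "u \<in> words" using u(1) Pref_words by blast
  then have "u \<noteq> []" by (simp add: words_def)
  then obtain u' a where u': "u = u' @ [a]" by (metis append_butlast_last_id)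
  show ?thesis
  proof (cases "u' = []")
    case True
    have "a \<in> letters" using rho_ends(3)[OF \<open>u \<in> words\<close> u(2)] by (simp add: u')
    then have "i = row a" "x = entry a" using u(2) by (simp_all add: u' True rho_letter)
    then show ?thesis using u v by (auto simp: u' True last_mul_rel_def K_nonzero_def)
  next
    case False
    have w: "u' \<in> words" "a \<in> arcs X" using \<open>u \<in> words\<close> False by (auto simp: u' words_def)
    obtain x' l' p where \<rho>u: "\<rho> u' = Some (i, x', l')" and a: "a \<in> letters"
      and p: "P l' (row a) = Some p" and x: "x = mult S (mult S x' p) (entry a)"
      using rho_snoc_Some[OF w u(2)[unfolded u']] by metis
    have x': "x' \<in> arcs S" "head S x' = G l'" "l' \<in> \<Lambda>"
      using rho_in[OF w(1)] \<rho>u by (simp_all add: M_iff)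
    have p': "p \<in> arcs S" "tail S p = G l'" "head S p = tail S (entry a)"
      using P_entries[OF x'(3) letter_in_M(1)[OF a] p] letter_in_M[OF a] by simp_all
    have y: "mult S x' p \<in> arcs S" "head S (mult S x' p) = tail S (entry a)"
      using x' p' by (simp_all add: mult_closed head_mult)
    have "head S x = head S (entry a)" using y letter_in_M[OF a] by (simp add: x head_mult)
    with g have "act g x = mult S (mult S x' p) (act g (entry a))"
      unfolding x by (intro act_mult y letter_in_M[OF a]) auto
    then have "mul (\<rho> u') (Some (row a, act g (entry a), m)) = Some (i, act g x, m)"
      by (simp add: \<rho>u p)
    then show ?thesis using u(1) v False by (auto simp: u' last_mul_rel_def K_nonzero_def)
  qed
qed

text \<open>One family covers all relations of a prefix-automatic structure: \<open>g\<close> is an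
  edge value, or \<open>None\<close> for an empty path; \<open>V\<close> restricts the target; and
  \<open>U\<close> is \<open>K_based\<close> or its set of prefixes.\<close>

definition value_rel :: "nat list set \<Rightarrow> 's option \<Rightarrow> 'o set \<Rightarrow> (nat list \<times> nat list) set" where
  "value_rel U g V = {(annotate None u, annotate None v) |u v. u \<in> U \<and> v \<in> K_based \<and>
     head S (eval (annotate None u)) \<in> V \<and> eval (annotate None v) = act g (eval (annotate None u))}"

text \<open>Among based words the value in \<open>S\<close> already fixes the row. The column of
  \<open>v\<close> is not fixed by it, so a finite union over columns and over last letters of
  \<open>u\<close> is taken.\<close>

lemma regular_value_rel:
  assumes U: "U \<subseteq> Pref K_based" "regular_rel (Id_on U)"
    and g: "\<And>s. g = Some s \<Longrightarrow> s \<in> arcs S \<and> V = {tail S s}"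
  shows "regular_rel (value_rel U g V)"
proof -
  \<comment> \<open>\<open>a\<close> stands for the last letter of \<open>u\<close> and
    \<open>b\<close> for that of \<open>v\<close>. As \<open>G (col a)\<close> is the target of the
    value of \<open>u\<close>, the restriction to \<open>V\<close> becomes a condition on
    \<open>a\<close>; the last condition places the triple in \<open>M\<close>.\<close>
  define H where "H = {(a, Some (row a, act g (entry a), col b)) |a b.
    a \<in> letters \<and> b \<in> letters \<and> G (col a) \<in> V \<and> G (col b) = head S (act g (entry a))}"
  define R where "R = (\<Union>(a, e)\<in>H. last_mul_rel a e)"
  have "H \<subseteq> (\<lambda>(a, b). (a, Some (row a, act g (entry a), col b))) ` (letters \<times> letters)"
    by (auto simp: H_def)
  then have "finite H" using finite_letters by (meson finite_SigmaI finite_imageI finite_subset)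
  moreover have "e \<in> M" if "(a, e) \<in> H" for a e
  proof -
    from that obtain b where a: "a \<in> letters" and b: "b \<in> letters" and V: "G (col a) \<in> V"
      and e: "e = Some (row a, act g (entry a), col b)" and h: "G (col b) = head S (act g (entry a))"
      by (auto simp: H_def)
    have "\<forall>s. g = Some s \<longrightarrow> s \<in> arcs S \<and> tail S s = head S (entry a)"
      using g V letter_in_M(5)[OF a] by auto
    from act_in[OF letter_in_M(2)[OF a] this] letter_in_M[OF a] letter_in_M[OF b] h
    show ?thesis by (simp add: e M_iff)
  qed
  ultimately have R: "regular_rel R"
    unfolding R_def by (intro regular_rel_UN) (auto intro: regular_last_mul_rel)
  have iff: "(u, v) \<in> R \<longleftrightarrow> head S (eval (annotate None u)) \<in> V \<and>
    eval (annotate None v) = act g (eval (annotate None u))" if u: "u \<in> Pref K_based" and v: "v \<in> K_based" for u v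
  proof -
    obtain i x l where uK: "u \<in> Pref K" "u \<in> words" and \<rho>u: "\<rho> u = Some (i, x, l)" and i: "i = base_row (F i)"
      using u by (rule Pref_K_based)
    obtain j y m where vK: "v \<in> K" "v \<in> words" and \<rho>v: "\<rho> v = Some (j, y, m)" and j: "j = base_row (F j)"
      using v by (rule K_based_Some)
    note ends = rho_ends[OF uK(2) \<rho>u] rho_ends[OF vK(2) \<rho>v]
    have ev: "eval (annotate None u) = x" "eval (annotate None v) = y"
      using annotate_path(2) uK \<rho>u vK \<rho>v by blast+
    have x: "x \<in> arcs S" "head S x = G l" "F i = tail S x"
      and y: "y \<in> arcs S" "head S y = G m" "F j = tail S y"
      using rho_in[OF uK(2)] rho_in[OF vK(2)] by (simp_all add: \<rho>u \<rho>v M_iff)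
    have le: "head S (entry (last u)) = head S x" using letter_in_M(5) ends x(2) by simp
    show ?thesis
    proof (cases "head S x \<in> V")
      case True
      then have g': "\<forall>s. g = Some s \<longrightarrow> s \<in> arcs S \<and> tail S s = head S x" using g by auto
      then have g'': "\<forall>s. g = Some s \<longrightarrow> s \<in> arcs S \<and> tail S s = head S (entry (last u))"
        using le by simp
      have hact: "head S (act g (entry (last u))) = head S (act g x)"
        unfolding act_in(3)[OF x(1) g'] act_in(3)[OF letter_in_M(2)[OF ends(3)] g''] le ..
      have "(u, v) \<in> R \<longleftrightarrow> (\<exists>b\<in>letters. G (col b) = head S (act g x) \<and>
        (u, v) \<in> last_mul_rel (last u) (Some (row (last u), act g (entry (last u)), col b)))"
      proof
        assume "(u, v) \<in> R"
        then obtain a b where ab: "a \<in> letters" "b \<in> letters" "G (col b) = head S (act g (entry a))"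
          and D: "(u, v) \<in> last_mul_rel a (Some (row a, act g (entry a), col b))"
          by (auto simp: R_def H_def)
        from D have "a = last u" by (auto simp: last_mul_rel_def)
        with ab D hact show "\<exists>b\<in>letters. G (col b) = head S (act g x) \<and>
          (u, v) \<in> last_mul_rel (last u) (Some (row (last u), act g (entry (last u)), col b))" by auto
      next
        assume "\<exists>b\<in>letters. G (col b) = head S (act g x) \<and>
          (u, v) \<in> last_mul_rel (last u) (Some (row (last u), act g (entry (last u)), col b))"
        then obtain b where b: "b \<in> letters" "G (col b) = head S (act g x)"
          "(u, v) \<in> last_mul_rel (last u) (Some (row (last u), act g (entry (last u)), col b))" by blast
        then have "(last u, Some (row (last u), act g (entry (last u)), col b)) \<in> H"
          using ends True x(2) hact by (auto simp: H_def)
        with b(3) show "(u, v) \<in> R" unfolding R_def by blast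
      qed
      also have "\<dots> \<longleftrightarrow> (\<exists>b\<in>letters. G (col b) = head S (act g x) \<and> \<rho> v = Some (i, act g x, col b))"
        using last_mul_rel_iff[OF uK(1) \<rho>u vK(1) g'] by simp
      also have "\<dots> \<longleftrightarrow> y = act g x"
      proof
        assume eq: "y = act g x"
        \<comment> \<open>\<open>act\<close> leaves the source unchanged, so both values start at
          the same object, for which a single row was chosen.\<close>
        have "j = i" using i j x(3) y(3) act_in(2)[OF x(1) g'] eq by metis
        with eq ends y(2) \<rho>v show "\<exists>b\<in>letters. G (col b) = head S (act g x) \<and> \<rho> v = Some (i, act g x, col b)"
          by (intro bexI[of _ "last v"]) auto
      qed (auto simp: \<rho>v)
      finally show ?thesis using True by (simp add: ev)
    next
      case False
      have "(u, v) \<notin> R"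
      proof
        assume "(u, v) \<in> R"
        then obtain a b where "G (col a) \<in> V" "(u, v) \<in> last_mul_rel a (Some (row a, act g (entry a), col b))"
          by (auto simp: R_def H_def)
        moreover from this(2) have "a = last u" by (auto simp: last_mul_rel_def)
        ultimately show False using False ends x(2) by simp
      qed
      then show ?thesis using False by (simp add: ev)
    qed
  qed
  \<comment> \<open>Composing with the graph of \<open>annotate None\<close> on both sides carries a
    relation between words of \<open>M\<close> over to paths of \<open>Y\<close>.\<close>
  define N where "N = {(u, annotate None u) |u. u \<in> lists (arcs X)}"
  have in_N: "(u, annotate None u) \<in> N" if "u \<in> Pref K_based" for u
    using that by (auto simp: N_def words_def elim!: Pref_K_based)
  have "value_rel U g V = N\<inverse> O (Id_on U O R O Id_on K_based) O N"
  proof (intro equalityI subsetI)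
    fix z assume "z \<in> value_rel U g V"
    then obtain u v where z: "z = (annotate None u, annotate None v)" and u: "u \<in> U" and v: "v \<in> K_based"
      and "head S (eval (annotate None u)) \<in> V" "eval (annotate None v) = act g (eval (annotate None u))"
      by (auto simp: value_rel_def)
    with iff have "(u, v) \<in> R" using U(1) by blast
    moreover have "(u, annotate None u) \<in> N" "(v, annotate None v) \<in> N"
      using in_N u v U(1) K_based_Pref by blast+
    ultimately show "z \<in> N\<inverse> O (Id_on U O R O Id_on K_based) O N"
      using u v unfolding z by blast
  next
    fix z assume "z \<in> N\<inverse> O (Id_on U O R O Id_on K_based) O N"
    then obtain u v where "z = (annotate None u, annotate None v)" "u \<in> U" "v \<in> K_based" "(u, v) \<in> R"
      unfolding N_def by blast
    with iff[of u v] U(1) show "z \<in> value_rel U g V" unfolding value_rel_def by blast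
  qed
  moreover have "regular_rel N" unfolding N_def by (rule regular_rel_annotate[OF finite_X])
  ultimately show ?thesis
    using R U(2) by (simp add: regular_rel_relcomp regular_rel_converse regular_K_based)
qed

text \<open>All three kinds of relation are instances of \<open>value_rel\<close>. The prefix
  relation needs a converse, since \<open>value_rel\<close> takes the prefix as first component, and
  \<open>V\<close> is \<open>UNIV\<close> there because no vertex is fixed.\<close>

lemma prefix_automatic_structure_Y: "prefix_automatic_structure S Y (annotate None ` K_based) eval"
proof -
  have sync: "synchronously_regular Y R" if "R \<subseteq> paths \<times> paths" "regular_rel R" for R
    using that finite_verts wf_Y finite_Y by (intro synchronously_regularI) (simp_all add: Y_def)
  have paths: "annotate None u \<in> paths" if "u \<in> K_based \<or> u \<in> Pref K_based" for u
    using that annotate_Pref_K_based K_based_Pref by blast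
  have head: "head (free_semigroupoid Y) w = head S (eval w)" if "w \<in> paths" for w
    using eval_path(3)[OF that] by (simp add: free_semigroupoid_def)
  have edge: "synchronously_regular Y (edge_relation Y (annotate None ` K_based) eval c)"
    if c: "c \<in> arcs Y" for c
  proof (rule sync)
    show "edge_relation Y (annotate None ` K_based) eval c \<subseteq> paths \<times> paths"
      using paths by (auto simp: edge_relation_def)
    have cp: "[c] \<in> paths" using c by (simp add: paths_iff)
    have ev: "eval (w @ [c]) = act (Some (val c)) (eval w)"
      if "w \<in> paths" "head S (eval w) = tail Y c" for w
      using eval_append[OF that(1) cp] that eval_path(3)[OF that(1)] by (simp add: act_def)
    have "edge_relation Y (annotate None ` K_based) eval c =
      value_rel K_based (Some (val c)) {tail S (val c)}"
    proof (intro equalityI subsetI)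
      fix z assume "z \<in> edge_relation Y (annotate None ` K_based) eval c"
      then obtain u v where z: "z = (annotate None u, annotate None v)" "u \<in> K_based" "v \<in> K_based"
        and h: "head (free_semigroupoid Y) (annotate None u) = tail Y c"
        and e: "eval (annotate None u @ [c]) = eval (annotate None v)"
        by (auto simp: edge_relation_def)
      have h': "head S (eval (annotate None u)) = tail Y c" using h head paths z(2) by simp
      with e ev[OF paths this] z show "z \<in> value_rel K_based (Some (val c)) {tail S (val c)}"
        unfolding value_rel_def Y_def by fastforce
    next
      fix z assume "z \<in> value_rel K_based (Some (val c)) {tail S (val c)}"
      then obtain u v where z: "z = (annotate None u, annotate None v)" "u \<in> K_based" "v \<in> K_based"
        and h: "head S (eval (annotate None u)) = tail S (val c)"
        and e: "eval (annotate None v) = act (Some (val c)) (eval (annotate None u))"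
        by (auto simp: value_rel_def)
      have h': "head S (eval (annotate None u)) = tail Y c" using h by (simp add: Y_def)
      then have "head (free_semigroupoid Y) (annotate None u) = tail Y c" using head paths z(2) by simp
      with e ev[OF paths h'] z show "z \<in> edge_relation Y (annotate None ` K_based) eval c"
        by (auto simp: edge_relation_def)
    qed
    moreover have "regular_rel (value_rel K_based (Some (val c)) {tail S (val c)})"
      by (rule regular_value_rel[OF K_based_Pref regular_K_based]) (use val_in[OF c] in simp)
    ultimately show "regular_rel (edge_relation Y (annotate None ` K_based) eval c)" by simp
  qed
  have vertex: "synchronously_regular Y (vertex_relation Y (annotate None ` K_based) eval t)" for t
  proof (rule sync)
    show "vertex_relation Y (annotate None ` K_based) eval t \<subseteq> paths \<times> paths"
      using paths by (auto simp: vertex_relation_def)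
    have "vertex_relation Y (annotate None ` K_based) eval t = value_rel K_based None {t}"
      using paths by (auto simp: vertex_relation_def value_rel_def act_def head)
    moreover have "regular_rel (value_rel K_based None {t})"
      by (rule regular_value_rel[OF K_based_Pref regular_K_based]) simp
    ultimately show "regular_rel (vertex_relation Y (annotate None ` K_based) eval t)" by simp
  qed
  have "synchronously_regular Y
    {(u, v) \<in> annotate None ` K_based \<times> Pref (annotate None ` K_based). eval u = eval v}" (is "synchronously_regular Y ?Q")
  proof (rule sync)
    show "?Q \<subseteq> paths \<times> paths"
      using paths by (auto simp: Pref_annotate)
    have "?Q = (value_rel (Pref K_based) None UNIV)\<inverse>"
      by (auto simp: value_rel_def act_def Pref_annotate)
    moreover have "regular_rel (value_rel (Pref K_based) None UNIV)"
      by (rule regular_value_rel[OF order.refl regular_rel_Pref[OF regular_K_based]]) simp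
    ultimately show "regular_rel ?Q" by (simp add: regular_rel_converse)
  qed
  with edge vertex choice_Y finite_Y show ?thesis
    by (simp add: prefix_automatic_structure_def automatic_structure_def)
qed

end

theorem theorem5p3:
  fixes S :: "('o, 's) semigroupoid"
    and I :: "'i set" and \<Lambda> :: "'l set"
    and F :: "'i \<Rightarrow> 'o" and G :: "'l \<Rightarrow> 'o"
    and P :: "'l \<Rightarrow> 'i \<Rightarrow> 's option"
  assumes "rees_matrix_data S I \<Lambda> F G P"
    and "prefix_automatic (rees_matrix_semigroup S I \<Lambda> F G P)"
  shows "prefix_automatic S"
proof -
  from assms(2) obtain X :: "(unit, nat) pre_digraph" and K \<rho>
    where "prefix_automatic_structure (rees_matrix_semigroup S I \<Lambda> F G P) X K \<rho>"
    unfolding prefix_automatic_def by blast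
  with assms(1) interpret rees_prefix_structure S I \<Lambda> F G P X K \<rho>
    by (simp add: rees_prefix_structure_def rees_prefix_structure_axioms_def)
  show ?thesis
    using prefix_automatic_structure_Y unfolding prefix_automatic_def by blast
qed

end
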